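(* Let $0<\lambda<\Lambda$ and $\mathcal{A}=\{a\in L_\infty(0,1) : \lambda\le a\le\Lambda\}$. Let $f\in L_1(0,1)$ and $a,b\in\mathcal{A}$. Let $F(x)=\int_0^x f(t)\,dt$, $F_{\min}=\min_{x\in[0,1]}F(x)$, $F_{\max}=\max_{x\in[0,1]}F(x)$ (with $F_{\min}<F_{\max}$), and for $\rho>0$ and $M\in(F_{\min},F_{\max})$ let $$K_\rho(M)=\{x\in(0,1) : |F(x)-M|\le\rho\}.$$ Assume there exist $\alpha\ge 0$, $\beta>0$, and positive constants $C_1,C_2$ independent of $\rho$, such that for all sufficiently small $\rho>0$ (i.e. for all $\rho\in(0,\rho_0]$ with some $\rho_0>0$) $$C_1\rho^\alpha\le\inf_{F_{\min}<M<F_{\max}}|K_\rho(M)|\le\sup_{F_{\min}<M<F_{\max}}|K_\rho(M)|\le C_2\rho^\beta .$$ Then for $1\le p\le 2$, $$\|a-b\|_{L_p(0,1)}\le C\,\|u_a'-u_b'\|_{L_2(0,1)}^{\max\left\{\frac{2\beta}{(2+\alpha)(2+\beta)},\ \frac{p\beta}{(p+\alpha)(p+\beta)}\right\}},$$ and for $2<p<\infty$, $$\|a-b\|_{L_p(0,1)}\le C\,\|u_a'-u_b'\|_{L_2(0,1)}^{\frac{4\beta}{(2+\alpha)(2+\beta)p}},$$ where in each case $C$ is a positive constant depending on $\lambda$, $\Lambda$, $p$, and $f$.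
   Context: For $a\in\mathcal{A}$, $u_a\in H^1_0(0,1)$ denotes the unique weak solution of $-(a u')'=f$ on $(0,1)$ with homogeneous Dirichlet boundary conditions, that is, $\int_0^1 a u_a' v'\,dx=\int_0^1 f v\,dx$ for all $v\in H^1_0(0,1)$. $|E|$ denotes the Lebesgue measure of a set $E$. The constant $C$ is uniform in $a,b\in\mathcal{A}$. The quantities $\alpha,\beta,C_1,C_2,\rho_0$ in the hypothesis are regarded as data attached to $f$, so $C$ may depend on them. *)

theory Defs
  imports "HOL-Analysis.Analysis"
begin

text \<open>
  Functions on the unit interval are represented by total functions on the reals; all notions below
  only depend on their values almost everywhere in \<open>(0,1)\<close>.
\<close>

abbreviation unit_leb :: "real measure" where
  "unit_leb \<equiv> lebesgue_on {0<..<1}"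

definition Lp_space :: "real \<Rightarrow> (real \<Rightarrow> real) set" where
  "Lp_space p = {g \<in> borel_measurable unit_leb. integrable unit_leb (\<lambda>x. \<bar>g x\<bar> powr p)}"

definition Lp_norm :: "real \<Rightarrow> (real \<Rightarrow> real) \<Rightarrow> real" where
  "Lp_norm p g = (LINT x|unit_leb. \<bar>g x\<bar> powr p) powr (1 / p)"

definition admissible :: "real \<Rightarrow> real \<Rightarrow> (real \<Rightarrow> real) set" where
  "admissible lam Lam =
     {a \<in> borel_measurable unit_leb. AE x in unit_leb. lam \<le> a x \<and> a x \<le> Lam}"

text \<open>Smooth functions with compact support in the open unit interval.\<close>

definition test_functions :: "(real \<Rightarrow> real) set" where
  "test_functions =
     {\<phi>. (\<forall>n x. (deriv ^^ n) \<phi> differentiable (at x)) \<and> closure {x. \<phi> x \<noteq> 0} \<subseteq> {0<..<1}}"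

text \<open>
  \<open>H1_deriv u u'\<close>: the function \<open>u\<close> belongs to \<open>H\<^sup>1(0,1)\<close> and \<open>u'\<close> is (a representative of) its
  weak derivative.
\<close>

definition H1_deriv :: "(real \<Rightarrow> real) \<Rightarrow> (real \<Rightarrow> real) \<Rightarrow> bool" where
  "H1_deriv u u' \<longleftrightarrow> u \<in> Lp_space 2 \<and> u' \<in> Lp_space 2 \<and>
     (\<forall>\<phi>\<in>test_functions.
        (LINT x|unit_leb. u x * deriv \<phi> x) = - (LINT x|unit_leb. u' x * \<phi> x))"

text \<open>\<open>H\<^sup>1\<^sub>0(0,1)\<close> is the closure of the test functions in the norm of \<open>H\<^sup>1(0,1)\<close>.\<close>

definition H10 :: "(real \<Rightarrow> real) set" where
  "H10 = {u. \<exists>u'. H1_deriv u u' \<and>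
     (\<exists>\<phi>. (\<forall>n::nat. \<phi> n \<in> test_functions) \<and>
       (\<lambda>n. Lp_norm 2 (\<lambda>x. \<phi> n x - u x)) \<longlonglongrightarrow> 0 \<and>
       (\<lambda>n. Lp_norm 2 (\<lambda>x. deriv (\<phi> n) x - u' x)) \<longlonglongrightarrow> 0)}"

text \<open>
  \<open>weak_solution a f u u'\<close>: \<open>u\<close> is the weak solution of \<open>-(a u')' = f\<close> with homogeneous Dirichlet
  boundary conditions, and \<open>u'\<close> is its weak derivative. For admissible \<open>a\<close> and integrable \<open>f\<close>
  such \<open>u\<close> and \<open>u'\<close> exist and are unique up to null sets.
\<close>

definition weak_solution ::
    "(real \<Rightarrow> real) \<Rightarrow> (real \<Rightarrow> real) \<Rightarrow> (real \<Rightarrow> real) \<Rightarrow> (real \<Rightarrow> real) \<Rightarrow> bool" where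
  "weak_solution a f u u' \<longleftrightarrow> u \<in> H10 \<and> H1_deriv u u' \<and>
     (\<forall>v v'. v \<in> H10 \<and> H1_deriv v v' \<longrightarrow>
        (LINT x|unit_leb. a x * u' x * v' x) = (LINT x|unit_leb. f x * v x))"

definition primitive :: "(real \<Rightarrow> real) \<Rightarrow> real \<Rightarrow> real" where
  "primitive f x = (LINT t|lebesgue_on {0<..<x}. f t)"

text \<open>For integrable \<open>f\<close> the primitive is continuous, so infimum and supremum are attained.\<close>

definition primitive_min :: "(real \<Rightarrow> real) \<Rightarrow> real" where
  "primitive_min f = (INF x\<in>{0..1}. primitive f x)"

definition primitive_max :: "(real \<Rightarrow> real) \<Rightarrow> real" where
  "primitive_max f = (SUP x\<in>{0..1}. primitive f x)"

definition level_band :: "(real \<Rightarrow> real) \<Rightarrow> real \<Rightarrow> real \<Rightarrow> real set" where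
  "level_band f \<rho> M = {x \<in> {0<..<1}. \<bar>primitive f x - M\<bar> \<le> \<rho>}"

end

theory Submission
  imports Defs
begin

text \<open>
  In one dimension the equation can be integrated: if \<open>F\<close> is the primitive of \<open>f\<close>, then
  \<open>a u\<^sub>a' = M - F\<close> almost everywhere for a constant \<open>M\<close>, and likewise \<open>b u\<^sub>b' = N - F\<close>
  (\<open>weak_solution_flux\<close>). Since \<open>u\<^sub>a'\<close> and \<open>u\<^sub>b'\<close> have mean zero, both constants lie strictly between
  the extreme values of \<open>F\<close> (\<open>flux_constant_range\<close>), where the hypothesis controls the measure of the
  bands \<open>K\<^sub>\<rho>\<close>. Write \<open>\<delta>\<close> for the \<open>L\<^sub>2\<close> norm of \<open>u\<^sub>a' - u\<^sub>b'\<close>.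

  The lower bound on bands controls the gap \<open>D = \<bar>M - N\<bar>\<close>. On \<open>K\<^sub>\<rho>(N)\<close> with \<open>\<rho>\<close> a small multiple of
  \<open>D\<close>, the flux \<open>N - F\<close> is small and \<open>M - F\<close> is comparable to \<open>D\<close>, so \<open>\<bar>u\<^sub>a' - u\<^sub>b'\<bar>\<close> is at least a
  multiple of \<open>D\<close> on a set of measure at least a multiple of \<open>D powr \<alpha>\<close>. Squaring and integrating
  gives \<open>D \<le> \<Gamma> * \<delta> powr (2 / (2 + \<alpha>))\<close> (\<open>flux_gap\<close>).

  The upper bound on bands then controls \<open>a - b\<close>. Off \<open>K\<^sub>\<rho>(N)\<close> the identity
  \<open>(a - b) u\<^sub>b' = (M - N) - a (u\<^sub>a' - u\<^sub>b')\<close> can be divided by \<open>u\<^sub>b'\<close>, which is at least a multiple of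
  \<open>\<rho>\<close> there; on \<open>K\<^sub>\<rho>(N)\<close>, a set of measure at most a multiple of \<open>\<rho> powr \<beta>\<close>, the coefficients are
  merely bounded. With \<open>y = \<delta> powr (2 / (2 + \<alpha>))\<close> and the width \<open>\<rho> = y powr (p / (p + \<beta>))\<close>, for which
  the two contributions are of equal size, the \<open>L\<^sub>p\<close> norm of \<open>a - b\<close> for \<open>1 \<le> p \<le> 2\<close> is at most a
  multiple of \<open>\<delta> powr (2 * \<beta> / ((2 + \<alpha>) * (p + \<beta>)))\<close> (\<open>Lp_norm_estimate\<close>, \<open>holder_stable_le_2\<close>). This
  exponent is at least both of the claimed ones. The case \<open>p > 2\<close> follows from \<open>p = 2\<close> since the
  coefficients are bounded.

  The first half of the development prepares the integrated equation. The weak formulation only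
  speaks of test functions, so it needs enough of them: explicit bumps built from \<open>exp (- 1 / x)\<close>
  approximate the indicators of all intervals, whence the fundamental lemma of the calculus of
  variations and the lemma of du Bois-Reymond (\<open>fundamental_lemma\<close>, \<open>du_Bois_Reymond\<close>).
\<close>

section \<open>Smooth functions of one real variable\<close>
definition smooth_fun :: "(real \<Rightarrow> real) \<Rightarrow> bool" where
  "smooth_fun f \<longleftrightarrow> (\<forall>n x. (deriv ^^ n) f differentiable (at x))"

lemma smooth_fun_DERIV: "smooth_fun f \<Longrightarrow> (f has_real_derivative deriv f x) (at x)"
  unfolding smooth_fun_def by (metis DERIV_deriv_iff_real_differentiable funpow_0)

lemma smooth_fun_deriv: "smooth_fun f \<Longrightarrow> smooth_fun (deriv f)"
  unfolding smooth_fun_def by (metis comp_apply funpow_Suc_right)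

lemma smooth_fun_if_smooth_deriv:
  assumes "\<And>x. (f has_real_derivative g x) (at x)" and "smooth_fun g"
  shows "smooth_fun f"
  unfolding smooth_fun_def
proof (intro allI)
  fix n x
  have g: "deriv f = g" using DERIV_imp_deriv[OF assms(1)] by auto
  show "(deriv ^^ n) f differentiable (at x)"
  proof (cases n)
    case 0 then show ?thesis using assms(1) by (auto simp: real_differentiable_def)
  next
    case (Suc m) then show ?thesis using assms(2) g unfolding smooth_fun_def
      by (simp add: funpow_Suc_right del: funpow.simps)
  qed
qed

text \<open>
Derivatives of products, or of \<open>exp (- 1 / x) / x ^ n\<close>, are not of the same form again but sums of
such functions. Linear combinations therefore have to be carried along in every proof of smoothness.
\<close>
inductive_set lin_span :: "(real \<Rightarrow> real) set \<Rightarrow> (real \<Rightarrow> real) set" for B where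
  base: "f \<in> B \<Longrightarrow> f \<in> lin_span B"
| add: "f \<in> lin_span B \<Longrightarrow> g \<in> lin_span B \<Longrightarrow> (\<lambda>x. f x + g x) \<in> lin_span B"
| scale: "f \<in> lin_span B \<Longrightarrow> (\<lambda>x. c * f x) \<in> lin_span B"

text \<open>
Smoothness by coinduction: if differentiation maps a family into its own linear span, then it maps
the span into itself, so it can be repeated for ever. All closure properties below are instances.
\<close>
lemma smooth_fun_lin_span:
  assumes B: "\<And>f. f \<in> B \<Longrightarrow> \<exists>g \<in> lin_span B. \<forall>x. (f has_real_derivative g x) (at x)"
    and f: "f \<in> lin_span B"
  shows "smooth_fun f"
proof -
  have step: "\<exists>g \<in> lin_span B. \<forall>x. (f has_real_derivative g x) (at x)" if "f \<in> lin_span B" for f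
    using that
  proof induction
    case (base f) then show ?case by (rule B)
  next
    case (add f g)
    then obtain f' g' where "f' \<in> lin_span B" "\<forall>x. (f has_real_derivative f' x) (at x)"
      "g' \<in> lin_span B" "\<forall>x. (g has_real_derivative g' x) (at x)" by blast
    then show ?case
      by (intro bexI[of _ "\<lambda>x. f' x + g' x"] allI DERIV_add lin_span.add) auto
  next
    case (scale f c)
    then obtain f' where "f' \<in> lin_span B" "\<forall>x. (f has_real_derivative f' x) (at x)" by blast
    then show ?case
      by (intro bexI[of _ "\<lambda>x. c * f' x"] allI DERIV_cmult lin_span.scale) auto
  qed
  have "(deriv ^^ n) f \<in> lin_span B" for n
  proof (induction n)
    case (Suc n)
    then obtain g where "g \<in> lin_span B" "\<forall>x. ((deriv ^^ n) f has_real_derivative g x) (at x)"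
      using step by blast
    moreover from this have "deriv ((deriv ^^ n) f) = g" using DERIV_imp_deriv by blast
    ultimately show ?case by simp
  qed (simp add: f)
  then show ?thesis unfolding smooth_fun_def using step real_differentiable_def by blast
qed

lemma smooth_fun_combination:
  assumes "smooth_fun f" "smooth_fun g"
  shows "smooth_fun (\<lambda>x. f x + c * g x)"
proof (rule smooth_fun_lin_span[where B = "Collect smooth_fun"])
  show "(\<lambda>x. f x + c * g x) \<in> lin_span (Collect smooth_fun)"
    by (intro lin_span.intros) (use assms in auto)
qed (use smooth_fun_DERIV smooth_fun_deriv in \<open>blast intro: lin_span.base\<close>)

lemma smooth_fun_mult:
  assumes "smooth_fun f" "smooth_fun g"
  shows "smooth_fun (\<lambda>x. f x * g x)"
proof (rule smooth_fun_lin_span)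
  let ?B = "{(\<lambda>x. f x * g x) | f g. smooth_fun f \<and> smooth_fun g}"
  show "(\<lambda>x. f x * g x) \<in> lin_span ?B"
    by (intro lin_span.base) (use assms in auto)
  fix h assume "h \<in> ?B"
  then obtain f g where h: "h = (\<lambda>x. f x * g x)" "smooth_fun f" "smooth_fun g" by auto
  have "(h has_real_derivative deriv f x * g x + deriv g x * f x) (at x)" for x
    unfolding h(1) by (intro DERIV_mult smooth_fun_DERIV h)
  moreover have "(\<lambda>x. deriv f x * g x + deriv g x * f x) \<in> lin_span ?B"
    by (intro lin_span.add lin_span.base) (use h smooth_fun_deriv in auto)
  ultimately show "\<exists>g \<in> lin_span ?B. \<forall>x. (h has_real_derivative g x) (at x)"
    by (intro bexI[where x = "\<lambda>x. deriv f x * g x + deriv g x * f x"] allI)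
qed

lemma smooth_fun_affine:
  assumes "smooth_fun f"
  shows "smooth_fun (\<lambda>x. f (m * x + t))"
proof (rule smooth_fun_lin_span)
  let ?B = "{(\<lambda>x. f (m * x + t)) | f. smooth_fun f}"
  show "(\<lambda>x. f (m * x + t)) \<in> lin_span ?B"
    by (intro lin_span.base) (use assms in auto)
  fix h assume "h \<in> ?B"
  then obtain f where h: "h = (\<lambda>x. f (m * x + t))" "smooth_fun f" by auto
  have "(h has_real_derivative m * deriv f (m * x + t)) (at x)" for x
    unfolding h(1)
    by (rule DERIV_cong[OF DERIV_chain'[where g = f and f = "\<lambda>x. m * x + t" and E = "deriv f (m * x + t)"]])
       (auto intro!: derivative_eq_intros smooth_fun_DERIV h)
  moreover have "(\<lambda>x. m * deriv f (m * x + t)) \<in> lin_span ?B"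
    by (intro lin_span.scale lin_span.base) (use h smooth_fun_deriv in auto)
  ultimately show "\<exists>g \<in> lin_span ?B. \<forall>x. (h has_real_derivative g x) (at x)"
    by (intro bexI[where x = "\<lambda>x. m * deriv f (m * x + t)"] allI)
qed

text \<open>
The powers of \<open>1 / x\<close> are needed because differentiating \<open>exp (- 1 / x)\<close> produces them.
\<close>
definition flat_exp :: "nat \<Rightarrow> real \<Rightarrow> real" where
  "flat_exp n x = (if 0 < x then (1 / x) ^ n * exp (- (1 / x)) else 0)"

lemma flat_exp_tendsto_0: "(flat_exp n \<longlongrightarrow> 0) (at_right 0)"
proof -
  have "((\<lambda>y::real. y ^ n / exp y) \<longlongrightarrow> 0) at_top" by (rule tendsto_power_div_exp_0)
  moreover have "LIM x (at_right (0::real)). inverse x :> at_top"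
    by (rule filterlim_inverse_at_top_right)
  ultimately have "((\<lambda>x. inverse x ^ n / exp (inverse x)) \<longlongrightarrow> (0::real)) (at_right 0)"
    by (rule filterlim_compose)
  then show ?thesis
    by (rule Lim_transform_eventually)
       (auto simp: flat_exp_def exp_minus field_simps eventually_at_right_field intro!: exI[of _ 1])
qed

text \<open>
At the origin the difference quotient of one member of the family is the next member, which tends
to zero since the exponential beats every power.
\<close>
lemma flat_exp_DERIV:
  "(flat_exp n has_real_derivative flat_exp (n + 2) x + - real n * flat_exp (n + 1) x) (at x)"
proof -
  consider "x < 0" | "x = 0" | "x > 0" by linarith
  then show ?thesis
  proof cases
    case 1
    have "((\<lambda>x. 0) has_real_derivative flat_exp (n + 2) x + - real n * flat_exp (n + 1) x) (at x)"
      using 1 by (simp add: flat_exp_def)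
    then show ?thesis
      by (rule has_field_derivative_transform_within_open[where S = "{..<0}"])
         (use 1 in \<open>auto simp: flat_exp_def\<close>)
  next
    case 2
    have "((\<lambda>y. flat_exp n y / y) \<longlongrightarrow> 0) (at 0)"
    proof (rule filterlim_split_at)
      show "((\<lambda>y. flat_exp n y / y) \<longlongrightarrow> 0) (at_left 0)"
        by (rule Lim_transform_eventually[OF tendsto_const])
           (auto simp: flat_exp_def eventually_at_left_field intro!: exI[of _ "-1"])
      show "((\<lambda>y. flat_exp n y / y) \<longlongrightarrow> 0) (at_right 0)"
        by (rule Lim_transform_eventually[OF flat_exp_tendsto_0[of "Suc n"]])
           (auto simp: flat_exp_def eventually_at_right_field intro!: exI[of _ "1"])
    qed
    then show ?thesis using 2 by (simp add: has_field_derivative_iff flat_exp_def)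
  next
    case 3
    have "((\<lambda>x. (1 / x) ^ n * exp (- (1 / x))) has_real_derivative 
        flat_exp (n + 2) x + - real n * flat_exp (n + 1) x) (at x)"
      using 3
      apply (auto intro!: derivative_eq_intros simp: flat_exp_def power2_eq_square)
      apply (cases n)
       apply (auto simp: field_simps power_add)
      done
    then show ?thesis
      by (rule has_field_derivative_transform_within_open[where S = "{0<..}"])
         (use 3 in \<open>auto simp: flat_exp_def\<close>)
  qed
qed

lemma smooth_fun_flat_exp: "smooth_fun (flat_exp n)"
proof (rule smooth_fun_lin_span[where B = "range flat_exp"])
  fix f assume "f \<in> range flat_exp"
  then obtain n where f: "f = flat_exp n" by auto
  show "\<exists>g \<in> lin_span (range flat_exp). \<forall>x. (f has_real_derivative g x) (at x)"
    unfolding f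
    by (intro bexI[where x = "\<lambda>x. flat_exp (n + 2) x + - real n * flat_exp (n + 1) x"] allI
          flat_exp_DERIV lin_span.add lin_span.scale lin_span.base) auto
qed (auto intro: lin_span.base)

section \<open>Test functions\<close>
text \<open>
On \<open>{c<..<d}\<close> this is \<open>exp (- 1 / (k * (x - c)) - 1 / (k * (d - x)))\<close>. Enlarging \<open>k\<close> flattens the bump
towards \<open>1\<close> without enlarging its support, so bumps approximate indicators from below.
\<close>
definition bump :: "real \<Rightarrow> real \<Rightarrow> real \<Rightarrow> real \<Rightarrow> real" where
  "bump k c d x = flat_exp 0 (k * (x - c)) * flat_exp 0 (k * (d - x))"

lemma smooth_fun_bump: "smooth_fun (bump k c d)"
proof -
  have "smooth_fun (\<lambda>x. flat_exp 0 (k * x + (- k * c)) * flat_exp 0 (- k * x + k * d))"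
    by (intro smooth_fun_mult smooth_fun_affine smooth_fun_flat_exp)
  then show ?thesis unfolding bump_def by (simp add: algebra_simps)
qed

lemma bump_eq:
  "k > 0 \<Longrightarrow> bump k c d x = (if c < x \<and> x < d then exp (- 1 / (k * (x - c)) - 1 / (k * (d - x))) else 0)"
  by (auto simp: bump_def flat_exp_def zero_less_mult_iff exp_add[symmetric])

lemma bump_nonneg: "0 \<le> bump k c d x"
  by (auto simp: bump_def flat_exp_def)

lemma bump_le_1: "bump k c d x \<le> 1"
  unfolding bump_def flat_exp_def by (auto intro!: mult_le_one)

text \<open>
The support enters below only through an interval outside of which the function vanishes, which is
easier to handle than the closure of the set of its nonzeros.
\<close>
lemma test_functions_iff:
  "\<phi> \<in> test_functions \<longleftrightarrow> smooth_fun \<phi> \<and> (\<exists>c d. 0 < c \<and> c < d \<and> d < 1 \<and> (\<forall>x. x \<notin> {c..d} \<longrightarrow> \<phi> x = 0))"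
proof
  assume "\<phi> \<in> test_functions"
  then have s: "smooth_fun \<phi>" and cl: "closure {x. \<phi> x \<noteq> 0} \<subseteq> {0<..<1}"
    by (auto simp: test_functions_def smooth_fun_def)
  have "compact (closure {x. \<phi> x \<noteq> 0})"
    unfolding compact_eq_bounded_closed
    by (intro conjI bounded_subset[OF _ cl] closed_closure bounded_subset[OF bounded_closed_interval[of 0 1]]) auto
  have "\<exists>c d. 0 < c \<and> c < d \<and> d < 1 \<and> closure {x. \<phi> x \<noteq> 0} \<subseteq> {c..d}"
  proof (cases "closure {x. \<phi> x \<noteq> 0} = {}")
    case True
    then show ?thesis by (intro exI[of _ "1/3"] exI[of _ "1/2"]) auto
  next
    case False
    obtain s where s: "s \<in> closure {x. \<phi> x \<noteq> 0}" "\<And>t. t \<in> closure {x. \<phi> x \<noteq> 0} \<Longrightarrow> s \<le> t"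
      using compact_attains_inf[OF \<open>compact _\<close> False] by blast
    obtain t where t: "t \<in> closure {x. \<phi> x \<noteq> 0}" "\<And>s. s \<in> closure {x. \<phi> x \<noteq> 0} \<Longrightarrow> s \<le> t"
      using compact_attains_sup[OF \<open>compact _\<close> False] by blast
    have "0 < s" "t < 1" "s \<le> t" using s t cl by auto
    then show ?thesis
      by (intro exI[of _ s] exI[of _ "(t+1)/2"]) (use s(2) t(2) in fastforce)
  qed
  then obtain c d where cd: "0 < c" "c < d" "d < 1" "closure {x. \<phi> x \<noteq> 0} \<subseteq> {c..d}" by blast
  moreover have "\<forall>x. x \<notin> {c..d} \<longrightarrow> \<phi> x = 0"
    using cd(4) closure_subset[of "{x. \<phi> x \<noteq> 0}"] by blast
  ultimately show "smooth_fun \<phi> \<and> (\<exists>c d. 0 < c \<and> c < d \<and> d < 1 \<and> (\<forall>x. x \<notin> {c..d} \<longrightarrow> \<phi> x = 0))"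
    using s by blast
next
  assume "smooth_fun \<phi> \<and> (\<exists>c d. 0 < c \<and> c < d \<and> d < 1 \<and> (\<forall>x. x \<notin> {c..d} \<longrightarrow> \<phi> x = 0))"
  then obtain c d where s: "smooth_fun \<phi>" and cd: "0 < c" "c < d" "d < 1" "\<forall>x. x \<notin> {c..d} \<longrightarrow> \<phi> x = 0"
    by blast
  have "closure {x. \<phi> x \<noteq> 0} \<subseteq> {c..d}"
    by (rule closure_minimal) (use cd in auto)
  with cd s show "\<phi> \<in> test_functions"
    by (auto simp: test_functions_def smooth_fun_def)
qed

lemma bump_test_function:
  assumes "k > 0" "0 < c" "c < d" "d < 1" shows "bump k c d \<in> test_functions"
  unfolding test_functions_iff
  by (intro conjI smooth_fun_bump exI[of _ c] exI[of _ d]) (use assms in \<open>auto simp: bump_eq\<close>)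

lemma test_function_combination:
  assumes "\<phi> \<in> test_functions" "\<psi> \<in> test_functions"
  shows "(\<lambda>x. \<phi> x + c * \<psi> x) \<in> test_functions"
proof -
  obtain a b where ab: "0 < a" "a < b" "b < 1" "\<forall>x. x \<notin> {a..b} \<longrightarrow> \<phi> x = 0"
    using assms unfolding test_functions_iff by blast
  obtain a' b' where ab': "0 < a'" "a' < b'" "b' < 1" "\<forall>x. x \<notin> {a'..b'} \<longrightarrow> \<psi> x = 0"
    using assms unfolding test_functions_iff by blast
  have "\<forall>x. x \<notin> {min a a'..max b b'} \<longrightarrow> \<phi> x + c * \<psi> x = 0"
    using ab(4) ab'(4) by (simp add: min_le_iff_disj le_max_iff_disj)
  moreover have "0 < min a a'" "min a a' < max b b'" "max b b' < 1" using ab ab' by auto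
  moreover have "smooth_fun (\<lambda>x. \<phi> x + c * \<psi> x)"
    by (intro smooth_fun_combination) (use assms in \<open>auto simp: test_functions_iff\<close>)
  ultimately show ?thesis unfolding test_functions_iff by blast
qed

lemma test_function_mult:
  assumes "\<phi> \<in> test_functions" "\<psi> \<in> test_functions"
  shows "(\<lambda>x. \<phi> x * \<psi> x) \<in> test_functions"
proof -
  obtain a b where ab: "0 < a" "a < b" "b < 1" "\<forall>x. x \<notin> {a..b} \<longrightarrow> \<phi> x = 0"
    using assms unfolding test_functions_iff by blast
  have "smooth_fun (\<lambda>x. \<phi> x * \<psi> x)"
    by (intro smooth_fun_mult) (use assms in \<open>auto simp: test_functions_iff\<close>)
  moreover have "\<forall>x. x \<notin> {a..b} \<longrightarrow> \<phi> x * \<psi> x = 0" using ab by simp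
  ultimately show ?thesis unfolding test_functions_iff using ab by blast
qed

lemma test_function_deriv:
  assumes "\<phi> \<in> test_functions" shows "deriv \<phi> \<in> test_functions"
proof -
  obtain a b where ab: "0 < a" "a < b" "b < 1" "\<forall>x. x \<notin> {a..b} \<longrightarrow> \<phi> x = 0"
    using assms unfolding test_functions_iff by blast
  have "deriv \<phi> x = 0" if "x \<notin> {a..b}" for x
  proof -
    have "((\<lambda>x. 0) has_real_derivative 0) (at x)" by simp
    then have "(\<phi> has_real_derivative 0) (at x)"
      by (rule has_field_derivative_transform_within_open[where S = "- {a..b}"])
         (use that ab in auto)
    then show ?thesis by (rule DERIV_imp_deriv)
  qed
  then show ?thesis
    unfolding test_functions_iff
    by (intro conjI smooth_fun_deriv exI[of _ a] exI[of _ b])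
       (use assms ab in \<open>auto simp: test_functions_iff\<close>)
qed

lemma test_function_continuous:
  assumes "\<phi> \<in> test_functions" shows "continuous_on S \<phi>"
  using assms unfolding test_functions_iff
  by (meson DERIV_continuous_on has_field_derivative_at_within smooth_fun_DERIV)

lemma test_function_bounded:
  assumes "\<phi> \<in> test_functions" shows "\<exists>B. \<forall>x. \<bar>\<phi> x\<bar> \<le> B"
proof -
  have "compact (\<phi> ` {0..1})" by (intro compact_continuous_image test_function_continuous assms) auto
  then obtain B where B: "\<forall>y\<in>\<phi> ` {0..1}. norm y \<le> B" by (meson compact_imp_bounded bounded_iff)
  then have "B \<ge> 0" by force
  obtain a b where "0 < a" "b < 1" "\<forall>x. x \<notin> {a..b} \<longrightarrow> \<phi> x = 0"
    using assms unfolding test_functions_iff by blast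
  then have "\<phi> x = 0" if "x \<notin> {0..1}" for x using that by auto
  then have "\<bar>\<phi> x\<bar> \<le> B" for x
    using B \<open>B \<ge> 0\<close> by (cases "x \<in> {0..1}") auto
  then show ?thesis by blast
qed

text \<open>
The antiderivative vanishes to the left of the support because nothing has been integrated yet, and
to the right of it because everything has been and the mean is zero.
\<close>
lemma test_function_antideriv:
  assumes \<psi>: "\<psi> \<in> test_functions" and mean: "integral {0..1} \<psi> = 0"
  obtains \<phi> where "\<phi> \<in> test_functions" "deriv \<phi> = \<psi>"
proof -
  obtain a b where ab: "0 < a" "a < b" "b < 1" "\<forall>x. x \<notin> {a..b} \<longrightarrow> \<psi> x = 0" and s: "smooth_fun \<psi>"
    using \<psi> unfolding test_functions_iff by blast
  have int: "\<psi> integrable_on S" if "S = {c..d}" for S c d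
    unfolding that by (intro integrable_continuous_real test_function_continuous \<psi>)
  have zero: "integral S \<psi> = 0" if "\<And>x. x \<in> S \<Longrightarrow> \<psi> x = 0" for S
    using Henstock_Kurzweil_Integration.integral_cong[of S \<psi> "\<lambda>_. 0"] that by simp
  define \<phi> where "\<phi> x = integral {0..x} \<psi>" for x
  have left: "\<phi> x = 0" if "x < a" for x
    unfolding \<phi>_def by (rule zero) (use that ab in auto)
  have right: "\<phi> x = 0" if "x > b" for x
  proof -
    have "integral {0..max x 1} \<psi> = integral {0..1} \<psi> + integral {1..max x 1} \<psi>"
      by (rule Henstock_Kurzweil_Integration.integral_combine[symmetric]) (auto intro: int)
    also have "integral {1..max x 1} \<psi> = 0" by (rule zero) (use ab in auto)
    finally have "integral {0..max x 1} \<psi> = 0" using mean by simp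
    moreover have "integral {0..max x 1} \<psi> = integral {0..x} \<psi> + integral {x..max x 1} \<psi>"
      by (rule Henstock_Kurzweil_Integration.integral_combine[symmetric]) (use ab that in \<open>auto intro: int\<close>)
    moreover have "integral {x..max x 1} \<psi> = 0" by (rule zero) (use ab that in auto)
    ultimately show ?thesis unfolding \<phi>_def by simp
  qed
  have D: "(\<phi> has_real_derivative \<psi> x) (at x)" for x
  proof (cases "x < a")
    case True
    have "((\<lambda>x. 0) has_real_derivative \<psi> x) (at x)" using True ab by simp
    then show ?thesis
      by (rule has_field_derivative_transform_within_open[where S = "{..<a}"])
         (use True left in auto)
  next
    case False
    have "(\<phi> has_real_derivative \<psi> x) (at x within {0..x+1})"
      unfolding \<phi>_def
      by (rule integral_has_real_derivative) (use False ab in \<open>auto intro: test_function_continuous \<psi>\<close>)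
    moreover have "at x within {0..x+1} = at x"
      by (rule at_within_Icc_at) (use False ab in auto)
    ultimately show ?thesis by simp
  qed
  have "smooth_fun \<phi>" by (rule smooth_fun_if_smooth_deriv[OF D s])
  moreover have "\<forall>x. x \<notin> {a..b} \<longrightarrow> \<phi> x = 0" using left right by auto
  ultimately have "\<phi> \<in> test_functions" unfolding test_functions_iff using ab by blast
  moreover have "deriv \<phi> = \<psi>" using DERIV_imp_deriv[OF D] by auto
  ultimately show ?thesis by (rule that)
qed

section \<open>The fundamental lemma of the calculus of variations\<close>
interpretation unit_leb: finite_measure unit_leb
  by (rule finite_measureI) (simp add: emeasure_restrict_space space_restrict_space)

lemma measure_unit_leb_space: "measure unit_leb {0<..<1} = 1"
  by (simp add: measure_restrict_space)

lemma integrable_mult_bounded: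
  fixes g h :: "real \<Rightarrow> real"
  assumes "integrable unit_leb h" "g \<in> borel_measurable unit_leb" "AE x in unit_leb. \<bar>g x\<bar> \<le> B"
  shows "integrable unit_leb (\<lambda>x. h x * g x)"
proof (rule Bochner_Integration.integrable_bound)
  show "integrable unit_leb (\<lambda>x. B * h x)" using assms by simp
  show "(\<lambda>x. h x * g x) \<in> borel_measurable unit_leb" using assms by measurable
  show "AE x in unit_leb. norm (h x * g x) \<le> norm (B * h x)"
    using assms(3)
  proof eventually_elim
    case (elim x)
    then have "\<bar>h x\<bar> * \<bar>g x\<bar> \<le> \<bar>h x\<bar> * \<bar>B\<bar>" by (intro mult_left_mono) auto
    then show ?case by (simp add: abs_mult mult.commute)
  qed
qed

lemma integrable_bounded:
  fixes g :: "real \<Rightarrow> real"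
  assumes "g \<in> borel_measurable unit_leb" "AE x in unit_leb. \<bar>g x\<bar> \<le> B"
  shows "integrable unit_leb g"
  by (rule unit_leb.integrable_const_bound[where B = B]) (use assms in auto)

lemma test_function_measurable:
  assumes "\<phi> \<in> test_functions" shows "\<phi> \<in> borel_measurable unit_leb"
  by (intro continuous_imp_measurable_on_sets_lebesgue test_function_continuous assms) simp

lemma integrable_mult_test_function:
  assumes "integrable unit_leb h" "\<phi> \<in> test_functions"
  shows "integrable unit_leb (\<lambda>x. h x * \<phi> x)"
proof -
  obtain B where "\<And>x. \<bar>\<phi> x\<bar> \<le> B" using test_function_bounded[OF assms(2)] by blast
  then show ?thesis
    by (intro integrable_mult_bounded[where B = B] assms test_function_measurable) auto
qed

lemma integrable_test_function:
  assumes "\<phi> \<in> test_functions" shows "integrable unit_leb \<phi>"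
  using integrable_mult_test_function[of "\<lambda>_. 1" \<phi>] assms by simp

lemma LINT_test_function:
  assumes "\<phi> \<in> test_functions" shows "(LINT x|unit_leb. \<phi> x) = integral {0..1} \<phi>"
  using lebesgue_integral_eq_integral[OF integrable_test_function[OF assms]]
  by (simp add: integral_open_interval_real)

lemma LINT_deriv_test_function:
  assumes "\<phi> \<in> test_functions" shows "(LINT x|unit_leb. deriv \<phi> x) = 0"
proof -
  have "(deriv \<phi> has_integral \<phi> 1 - \<phi> 0) {0..1}"
    using assms
    by (intro fundamental_theorem_of_calculus)
       (auto simp: test_functions_iff has_real_derivative_iff_has_vector_derivative[symmetric]
         intro!: has_field_derivative_at_within smooth_fun_DERIV)
  moreover have "\<phi> 1 = 0" "\<phi> 0 = 0" using assms by (auto simp: test_functions_iff)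
  ultimately have "integral {0..1} (deriv \<phi>) = 0" by (simp add: integral_unique)
  then show ?thesis by (simp only: LINT_test_function[OF test_function_deriv[OF assms]])
qed

lemma LINT_bump_pos:
  assumes "k > 0" "0 < c" "c < d" "d < 1"
  shows "(LINT x|unit_leb. bump k c d x) > 0"
proof -
  have t: "bump k c d \<in> test_functions" using assms by (rule bump_test_function)
  have "integral {0..1} (bump k c d) \<noteq> 0"
  proof
    assume 0: "integral {0..1} (bump k c d) = 0"
    have "(bump k c d has_integral 0) (cbox 0 1)"
      using 0 integrable_integral[of "bump k c d" "{0..1}"]
      by (simp add: integrable_continuous_real test_function_continuous t)
    then have "bump k c d ((c + d) / 2) = 0"
      by (rule has_integral_0_cbox_imp_0[rotated 2])
         (use assms in \<open>auto simp: bump_nonneg intro: test_function_continuous t\<close>)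
    then show False using assms by (simp add: bump_eq split: if_splits)
  qed
  moreover have "(LINT x|unit_leb. bump k c d x) \<ge> 0"
    by (intro integral_nonneg_AE) (auto simp: bump_nonneg)
  ultimately show ?thesis using LINT_test_function[OF t] by linarith
qed

lemma flat_exp_0_tendsto_1: "(flat_exp 0 \<longlongrightarrow> 1) at_top"
proof -
  have "((\<lambda>x::real. exp (- (1 / x))) \<longlongrightarrow> exp (- 0)) at_top"
    by (intro tendsto_intros tendsto_divide_0[OF tendsto_const] filterlim_at_top_imp_at_infinity filterlim_ident)
  moreover have "\<forall>\<^sub>F x in at_top. exp (- (1 / x)) = flat_exp 0 x"
    by (auto simp: flat_exp_def eventually_at_top_dense intro!: exI[of _ 0])
  ultimately show ?thesis using Lim_transform_eventually by fastforce
qed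

text \<open>
The supports shrink slightly inside \<open>{c<..<d}\<close>, so that the endpoints \<open>0\<close> and \<open>1\<close> of the unit
interval may be reached.
\<close>
lemma indicator_limit_of_bumps:
  assumes "0 \<le> c" "c < d" "d \<le> 1"
  obtains \<theta> :: "nat \<Rightarrow> real \<Rightarrow> real"
  where "\<And>n. \<theta> n \<in> test_functions" "\<And>n x. \<bar>\<theta> n x\<bar> \<le> 1"
    "\<And>x. (\<lambda>n. \<theta> n x) \<longlonglongrightarrow> indicator {c<..<d} x"
proof
  define e where "e n = (d - c) / (real n + 3)" for n
  define \<theta> where "\<theta> n = bump (real n + 1) (c + e n) (d - e n)" for n
  have e_pos: "0 < e n" for n using assms by (simp add: e_def)
  have e_lt: "c + e n < d - e n" for n
  proof -
    have "2 * (d - c) < (d - c) * (real n + 3)" using assms by (subst mult.commute) (intro mult_strict_left_mono, auto)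
    then have "2 * e n < d - c" unfolding e_def by (simp add: field_simps)
    then show ?thesis by simp
  qed
  show "\<theta> n \<in> test_functions" for n
    unfolding \<theta>_def by (rule bump_test_function) (use e_pos[of n] e_lt assms in auto)
  show "\<bar>\<theta> n x\<bar> \<le> 1" for n x
    using bump_nonneg bump_le_1 unfolding \<theta>_def by (simp add: abs_le_iff order_trans[of _ 0])
  show "(\<lambda>n. \<theta> n x) \<longlonglongrightarrow> indicator {c<..<d} x" for x
  proof (cases "c < x \<and> x < d")
    case True
    have k: "filterlim (\<lambda>n. real n + 1) at_top sequentially"
      by (rule filterlim_at_top_mono[OF filterlim_real_sequentially]) simp
    have e: "e \<longlonglongrightarrow> 0"
      unfolding e_def
      by (intro tendsto_divide_0[OF tendsto_const] filterlim_at_top_imp_at_infinity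
            filterlim_at_top_mono[OF k]) auto
    have "(\<lambda>n. x - (c + e n)) \<longlonglongrightarrow> x - (c + 0)" "(\<lambda>n. d - e n - x) \<longlonglongrightarrow> d - 0 - x"
      by (intro tendsto_intros e)+
    note lim = this
    have "filterlim (\<lambda>n. (x - (c + e n)) * (real n + 1)) at_top sequentially"
      by (rule filterlim_tendsto_pos_mult_at_top[OF lim(1) _ k]) (use True in simp)
    moreover have "filterlim (\<lambda>n. (d - e n - x) * (real n + 1)) at_top sequentially"
      by (rule filterlim_tendsto_pos_mult_at_top[OF lim(2) _ k]) (use True in simp)
    ultimately have "(\<lambda>n. flat_exp 0 ((x - (c + e n)) * (real n + 1)) * flat_exp 0 ((d - e n - x) * (real n + 1)))
        \<longlonglongrightarrow> 1 * 1"
      by (intro tendsto_mult filterlim_compose[OF flat_exp_0_tendsto_1])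
    then show ?thesis using True by (simp add: \<theta>_def bump_def mult.commute)
  next
    case False
    have "\<theta> n x = 0" for n
      using False e_pos[of n] unfolding \<theta>_def by (subst bump_eq) auto
    then show ?thesis using False by simp
  qed
qed

text \<open>
Bumps converge boundedly to indicators of intervals, so \<open>h\<close> has integral zero over every interval.
Intervals generate the Borel sets and are stable under intersection, and a Lebesgue set differs from
a Borel set by a null set; hence \<open>h\<close> has integral zero over every measurable set.
\<close>
lemma fundamental_lemma:
  assumes h: "integrable unit_leb h"
    and 0: "\<And>\<phi>. \<phi> \<in> test_functions \<Longrightarrow> (LINT x|unit_leb. h x * \<phi> x) = 0"
  shows "AE x in unit_leb. h x = 0"
proof -
  have hm [measurable]: "h \<in> borel_measurable unit_leb" using h by auto
  have ivl: "(LINT x|unit_leb. indicator {c<..<d} x * h x) = 0" for c d :: real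
  proof (cases "max c 0 < min d 1")
    case True
    obtain \<theta> where \<theta>: "\<And>n. \<theta> n \<in> test_functions" "\<And>n x. \<bar>\<theta> n x\<bar> \<le> 1"
        "\<And>x. (\<lambda>n. \<theta> n x) \<longlonglongrightarrow> indicator {max c 0<..<min d 1} x"
    proof (rule indicator_limit_of_bumps)
      show "0 \<le> max c 0" "max c 0 < min d 1" "min d 1 \<le> 1" using True by auto
    qed blast
    have "(\<lambda>n. LINT x|unit_leb. h x * \<theta> n x)
        \<longlonglongrightarrow> (LINT x|unit_leb. h x * indicator {max c 0<..<min d 1} x)"
    proof (rule integral_dominated_convergence[where w = "\<lambda>x. \<bar>h x\<bar>"])
      show "AE x in unit_leb. (\<lambda>n. h x * \<theta> n x) \<longlonglongrightarrow> h x * indicator {max c 0<..<min d 1} x"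
        by (intro AE_I2 tendsto_mult tendsto_const \<theta>)
      show "AE x in unit_leb. norm (h x * \<theta> n x) \<le> \<bar>h x\<bar>" for n
        using \<theta>(2) by (intro AE_I2) (simp add: abs_mult mult_left_le)
      show "(\<lambda>x. h x * \<theta> n x) \<in> borel_measurable unit_leb" for n
        using test_function_measurable[OF \<theta>(1)] by measurable
      show "(\<lambda>x. h x * indicator {max c 0<..<min d 1} x) \<in> borel_measurable unit_leb"
        by (intro borel_measurable_times hm borel_measurable_indicator) (auto simp: sets_restrict_space)
      show "integrable unit_leb (\<lambda>x. \<bar>h x\<bar>)" using h by (rule integrable_abs)
    qed
    then have "(LINT x|unit_leb. h x * indicator {max c 0<..<min d 1} x) = 0"
      using 0[OF \<theta>(1)] by (simp add: LIMSEQ_const_iff)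
    moreover have "(LINT x|unit_leb. h x * indicator {max c 0<..<min d 1} x)
        = (LINT x|unit_leb. indicator {c<..<d} x * h x)"
      by (intro Bochner_Integration.integral_cong) (auto simp: indicator_def space_restrict_space)
    ultimately show ?thesis by simp
  next
    case False
    then have "(LINT x|unit_leb. indicator {c<..<d} x * h x) = (LINT x|unit_leb. 0)"
      by (intro Bochner_Integration.integral_cong) (auto simp: indicator_def space_restrict_space)
    then show ?thesis by simp
  qed
  have int: "integrable unit_leb (\<lambda>x. indicator A x * h x)" if "A \<in> sets borel" for A :: "real set"
  proof -
    have "indicator A \<in> borel_measurable unit_leb"
      using that by (intro measurable_restrict_space1 borel_measurable_indicator) auto
    then have "integrable unit_leb (\<lambda>x. h x * indicator A x)"
      by (rule integrable_mult_bounded[OF h, where B = 1]) (auto simp: indicator_def)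
    then show ?thesis by (simp add: mult.commute)
  qed
  have bor: "(LINT x|unit_leb. indicator A x * h x) = 0" if "A \<in> sets borel" for A :: "real set"
  proof -
    let ?E = "range (\<lambda>(a::real, b). {a<..<b})"
    have sets: "sets borel = sigma_sets UNIV ?E"
    proof -
      have eq: "(\<lambda>(a::real, b). box a b) = (\<lambda>(a, b). {a<..<b})" by (intro ext) (auto simp: box_real)
      have "sets borel = sigma_sets UNIV (range (\<lambda>(a::real, b). box a b))"
        by (subst borel_eq_box) simp
      then show ?thesis unfolding eq .
    qed
    have "Int_stable ?E"
    proof (rule Int_stableI_image)
      fix p q :: "real \<times> real"
      show "\<exists>r\<in>UNIV. (\<lambda>(a::real, b). {a<..<b}) p \<inter> (\<lambda>(a::real, b). {a<..<b}) q = (\<lambda>(a::real, b). {a<..<b}) r"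
        by (intro bexI[where x = "(max (fst p) (fst q), min (snd p) (snd q))"])
           (auto simp: case_prod_beta)
    qed
    moreover have "?E \<subseteq> Pow UNIV" by simp
    moreover have "A \<in> sigma_sets UNIV ?E" using that sets by simp
    ultimately show ?thesis
    proof (induction rule: sigma_sets_induct_disjoint)
      case (basic A) then show ?case using ivl by auto
    next
      case empty then show ?case by simp
    next
      case (compl A)
      have A: "A \<in> sets borel" using compl by (simp add: sets)
      have "(LINT x|unit_leb. indicator (UNIV - A) x * h x)
          = (LINT x|unit_leb. h x - indicator A x * h x)"
        by (intro Bochner_Integration.integral_cong) (auto simp: indicator_def)
      also have "\<dots> = (LINT x|unit_leb. h x) - (LINT x|unit_leb. indicator A x * h x)"
        by (rule Bochner_Integration.integral_diff[OF h int[OF A]])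
      also have "(LINT x|unit_leb. h x) = (LINT x|unit_leb. indicator {-1<..<2} x * h x)"
        by (intro Bochner_Integration.integral_cong) (auto simp: indicator_def space_restrict_space)
      finally show ?case using compl ivl by simp
    next
      case (union A)
      have A: "A i \<in> sets borel" for i using union by (auto simp: sets)
      have Am: "A i \<inter> {0<..<1} \<in> sets unit_leb" for i
        using A[of i] by (subst sets_restrict_space_iff) auto
      have *: "indicator (B \<inter> {0<..<1}) x * h x = indicator B x * h x"
        if "x \<in> space unit_leb" for x and B :: "real set"
        using that by (auto simp: indicator_def space_restrict_space)
      have U: "(\<Union>i. A i) \<in> sets borel" using A by auto
      have "(LINT x:(\<Union>i. A i \<inter> {0<..<1})|unit_leb. h x) = (\<Sum>i. (LINT x:(A i \<inter> {0<..<1})|unit_leb. h x))"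
      proof (rule lebesgue_integral_countable_add)
        show "A i \<inter> {0<..<1} \<inter> (A j \<inter> {0<..<1}) = {}" if "i \<noteq> j" for i j
          using union(1) that by (auto simp: disjoint_family_on_def)
        show "set_integrable unit_leb (\<Union>i. A i \<inter> {0<..<1}) h"
        proof -
          have "integrable unit_leb (\<lambda>x. indicator ((\<Union>i. A i) \<inter> {0<..<1}) x * h x)
              \<longleftrightarrow> integrable unit_leb (\<lambda>x. indicator (\<Union>i. A i) x * h x)"
            by (rule Bochner_Integration.integrable_cong[OF refl *])
          then show ?thesis using int[OF U] by (simp add: set_integrable_def)
        qed
        show "A i \<inter> {0<..<1} \<in> sets unit_leb" for i by (rule Am)
      qed
      moreover have "(LINT x:B \<inter> {0<..<1}|unit_leb. h x) = (LINT x|unit_leb. indicator B x * h x)"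
        for B :: "real set"
        unfolding set_lebesgue_integral_def real_scaleR_def
        by (rule Bochner_Integration.integral_cong[OF refl *])
      ultimately show ?case using union(3) by (simp flip: Int_UN_distrib2)
    qed
  qed
  show ?thesis
  proof (rule density_unique_real[OF h, of "\<lambda>_. 0", simplified])
    fix A assume A: "A \<in> sets unit_leb"
    then have AL: "A \<in> sets lebesgue" by (simp add: sets_restrict_space_iff)
    obtain C N T where CT: "A = C \<union> N" "N \<subseteq> T" "T \<in> null_sets lborel" "C \<in> sets lborel"
      by (rule sets_completionE[OF AL])
    then have C: "C \<in> sets borel" by simp
    have "AE x in lebesgue. x \<notin> T" using CT(3) by (intro AE_completion AE_not_in)
    then have "AE x in unit_leb. x \<notin> T" by (auto simp: AE_restrict_space_iff elim: eventually_mono)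
    then have "AE x in unit_leb. indicator A x * h x = indicator C x * h x"
      by eventually_elim (use CT in \<open>auto simp: indicator_def\<close>)
    then have "(LINT x|unit_leb. indicator A x * h x) = (LINT x|unit_leb. indicator C x * h x)"
      using A int[OF C] by (intro integral_cong_AE) auto
    with bor[OF C] show "(LINT x:A|unit_leb. h x) = 0"
      by (simp add: set_lebesgue_integral_def)
  qed
qed


text \<open>
A test function is a derivative of a test function precisely when its mean is zero. Subtracting a
multiple of one fixed bump from an arbitrary test function makes its mean zero, and the multiple
reappears as the constant \<open>m\<close>; the fundamental lemma then applies to \<open>g - m\<close>.
\<close>
lemma du_Bois_Reymond:
  assumes g: "integrable unit_leb g"
    and 0: "\<And>\<phi>. \<phi> \<in> test_functions \<Longrightarrow> (LINT x|unit_leb. g x * deriv \<phi> x) = 0"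
  obtains m where "AE x in unit_leb. g x = m"
proof -
  let ?\<eta> = "bump 1 (1/4) (3/4)"
  have \<eta>: "?\<eta> \<in> test_functions" by (rule bump_test_function) auto
  \<comment> \<open>Any bump would do: its mean is positive, so that it can be divided by.\<close>
  define I where "I = (LINT x|unit_leb. ?\<eta> x)"
  have "I > 0" unfolding I_def by (rule LINT_bump_pos) auto
  define m where "m = (LINT x|unit_leb. g x * ?\<eta> x) / I"
  have "AE x in unit_leb. g x - m = 0"
  proof (rule fundamental_lemma)
    show "integrable unit_leb (\<lambda>x. g x - m)" using g by simp
    fix \<theta> assume \<theta>: "\<theta> \<in> test_functions"
    define J where "J = (LINT x|unit_leb. \<theta> x)"
    let ?\<psi> = "\<lambda>x. \<theta> x + (- J / I) * ?\<eta> x"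
    have \<psi>: "?\<psi> \<in> test_functions" by (rule test_function_combination[OF \<theta> \<eta>])
    have "(LINT x|unit_leb. ?\<psi> x) = J + (- J / I) * I"
    proof -
      have "integrable unit_leb (\<lambda>x. (- J / I) * ?\<eta> x)"
        by (intro integrable_mult_right integrable_test_function \<eta>)
      then show ?thesis
        unfolding J_def I_def using integrable_test_function[OF \<theta>]
        by (subst Bochner_Integration.integral_add) auto
    qed
    also have "\<dots> = 0" using \<open>I > 0\<close> by simp
    finally have "integral {0..1} ?\<psi> = 0" using \<open>I > 0\<close> LINT_test_function[OF \<psi>] by linarith
    then obtain \<phi> where \<phi>: "\<phi> \<in> test_functions" "deriv \<phi> = ?\<psi>"
      using test_function_antideriv[OF \<psi>] by blast
    have "0 = (LINT x|unit_leb. g x * \<theta> x + (- J / I) * (g x * ?\<eta> x))"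
      using 0[OF \<phi>(1)] unfolding \<phi>(2) by (simp add: algebra_simps)
    also have "\<dots> = (LINT x|unit_leb. g x * \<theta> x) + (- J / I) * (LINT x|unit_leb. g x * ?\<eta> x)"
      by (subst Bochner_Integration.integral_add)
         (intro integrable_mult_test_function integrable_mult_right g \<theta> \<eta> | simp)+
    also have "\<dots> = (LINT x|unit_leb. g x * \<theta> x) - (LINT x|unit_leb. m * \<theta> x)"
      by (simp add: m_def J_def)
    also have "\<dots> = (LINT x|unit_leb. g x * \<theta> x - m * \<theta> x)"
      by (rule Bochner_Integration.integral_diff[symmetric])
         (intro integrable_mult_test_function integrable_mult_right integrable_test_function g \<theta>)+
    finally show "(LINT x|unit_leb. (g x - m) * \<theta> x) = 0" by (simp add: algebra_simps)
  qed
  then have "AE x in unit_leb. g x = m" by eventually_elim simp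
  then show ?thesis by (rule that)
qed

section \<open>Integration by parts against the primitive\<close>

lemma primitive_eq:
  assumes "x \<in> {0<..<1}"
  shows "primitive f x = (LINT t|unit_leb. f t * indicator {..<x} t)"
proof -
  have "primitive f x = (LINT t|lebesgue. indicator {0<..<x} t * f t)"
    unfolding primitive_def by (subst integral_restrict_space) auto
  also have "\<dots> = (LINT t|lebesgue. indicator {0<..<1} t * (f t * indicator {..<x} t))"
    by (intro Bochner_Integration.integral_cong) (use assms in \<open>auto simp: indicator_def\<close>)
  also have "\<dots> = (LINT t|unit_leb. f t * indicator {..<x} t)"
    by (subst integral_restrict_space) auto
  finally show ?thesis .
qed

lemma measurable_less_indicator:
  "(\<lambda>(t::real, x). indicator {..<x} t :: real) \<in> borel_measurable (unit_leb \<Otimes>\<^sub>M unit_leb)"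
proof -
  have id: "(\<lambda>x. x) \<in> measurable unit_leb borel"
    by (intro measurable_restrict_space1) (simp add: measurable_completion)
  have "(\<lambda>p. fst p) \<in> measurable (unit_leb \<Otimes>\<^sub>M unit_leb) borel"
       "(\<lambda>p. snd p) \<in> measurable (unit_leb \<Otimes>\<^sub>M unit_leb) borel"
    using measurable_compose[OF measurable_fst id] measurable_compose[OF measurable_snd id] by auto
  then have "(\<lambda>p. if fst p < snd p then 1 else 0 :: real) \<in> borel_measurable (unit_leb \<Otimes>\<^sub>M unit_leb)"
    by measurable
  then show ?thesis by (simp add: indicator_def case_prod_beta of_bool_def)
qed

lemma primitive_measurable:
  assumes "integrable unit_leb f"
  shows "primitive f \<in> borel_measurable unit_leb"
proof -
  have [measurable]: "f \<in> borel_measurable unit_leb" using assms by auto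
  have "(\<lambda>(x, t). indicator {..<x} t :: real) \<in> borel_measurable (unit_leb \<Otimes>\<^sub>M unit_leb)"
    using measurable_compose[OF measurable_pair_swap' measurable_less_indicator]
    by (simp add: case_prod_beta)
  then have "(\<lambda>p. f (snd p) * (case p of (x, t) \<Rightarrow> indicator {..<x} t)) \<in> borel_measurable (unit_leb \<Otimes>\<^sub>M unit_leb)"
    by measurable
  then have "(\<lambda>x. LINT t|unit_leb. f t * indicator {..<x} t) \<in> borel_measurable unit_leb"
    by (intro unit_leb.borel_measurable_lebesgue_integral) (simp add: case_prod_beta)
  then show ?thesis
    by (rule measurable_cong[THEN iffD1, rotated]) (simp add: primitive_eq space_restrict_space)
qed

lemma primitive_bound:
  assumes "integrable unit_leb f" "x \<in> {0<..<1}"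
  shows "\<bar>primitive f x\<bar> \<le> (LINT t|unit_leb. \<bar>f t\<bar>)"
proof -
  have m: "indicator {..<x} \<in> borel_measurable unit_leb"
    by (intro measurable_restrict_space1 borel_measurable_indicator) auto
  have i: "integrable unit_leb (\<lambda>t. f t * indicator {..<x} t)"
    by (rule integrable_mult_bounded[OF assms(1) m, where B = 1]) (auto simp: indicator_def)
  have "\<bar>primitive f x\<bar> \<le> (LINT t|unit_leb. \<bar>f t * indicator {..<x} t\<bar>)"
    unfolding primitive_eq[OF assms(2)] by (rule integral_abs_bound)
  also have "\<dots> \<le> (LINT t|unit_leb. \<bar>f t\<bar>)"
    using i assms(1) by (intro integral_mono) (auto simp: indicator_def)
  finally show ?thesis .
qed

text \<open>
The primitive of an integrable function need not be differentiable everywhere, so the product rule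
is replaced by Fubini's theorem: both sides are minus the integral of \<open>f t * deriv \<phi> x\<close> over the triangle
\<open>t < x\<close>, because \<open>\<phi>\<close> vanishes at \<open>1\<close>.
\<close>
lemma primitive_integration_by_parts:
  assumes f: "integrable unit_leb f" and \<phi>: "\<phi> \<in> test_functions"
  shows "(LINT x|unit_leb. f x * \<phi> x) = - (LINT x|unit_leb. primitive f x * deriv \<phi> x)"
proof -
  interpret P: pair_sigma_finite unit_leb unit_leb by unfold_locales
  have [measurable]: "f \<in> borel_measurable unit_leb" using f by auto
  have d: "deriv \<phi> \<in> test_functions" by (rule test_function_deriv[OF \<phi>])
  note [measurable] = test_function_measurable[OF d]
  have tail: "\<phi> t = - (LINT x|unit_leb. deriv \<phi> x * indicator {..<x} t)" if t: "t \<in> {0<..<1}" for t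
  proof -
    have "(LINT x|unit_leb. deriv \<phi> x * indicator {..<x} t)
        = (LINT x|lebesgue. indicator {0<..<1} x * (deriv \<phi> x * indicator {..<x} t))"
      by (subst integral_restrict_space) auto
    also have "\<dots> = (LINT x|lebesgue. indicator {t<..<1} x * deriv \<phi> x)"
      by (intro Bochner_Integration.integral_cong) (use t in \<open>auto simp: indicator_def\<close>)
    also have "\<dots> = (LINT x|lebesgue_on {t<..<1}. deriv \<phi> x)"
      by (subst integral_restrict_space) auto
    also have "\<dots> = integral {t<..<1} (deriv \<phi>)"
    proof (rule lebesgue_integral_eq_integral)
      have "integrable lebesgue (\<lambda>x. indicator {0<..<1} x * deriv \<phi> x)"
        using integrable_test_function[OF d] by (simp add: integrable_restrict_space)
      then have "integrable lebesgue (\<lambda>x. indicator {t<..<1} x *\<^sub>R (indicator {0<..<1} x * deriv \<phi> x))"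
        by (intro integrable_mult_indicator) auto
      also have "(\<lambda>x. indicator {t<..<1} x *\<^sub>R (indicator {0<..<1} x * deriv \<phi> x)) = (\<lambda>x. indicator {t<..<1} x * deriv \<phi> x)"
        using t by (auto simp: indicator_def)
      finally show "integrable (lebesgue_on {t<..<1}) (deriv \<phi>)" by (simp add: integrable_restrict_space)
    qed simp
    also have "\<dots> = integral {t..1} (deriv \<phi>)" by (simp add: integral_open_interval_real)
    also have "\<dots> = \<phi> 1 - \<phi> t"
      using \<phi> t
      by (intro integral_unique fundamental_theorem_of_calculus)
         (auto simp: test_functions_iff has_real_derivative_iff_has_vector_derivative[symmetric]
           intro!: has_field_derivative_at_within smooth_fun_DERIV)
    also have "\<phi> 1 = 0" using \<phi> by (auto simp: test_functions_iff)
    finally show ?thesis by simp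
  qed
  let ?k = "\<lambda>t x. f t * (deriv \<phi> x * indicator {..<x} t)"
  obtain B where B: "\<And>x. \<bar>deriv \<phi> x\<bar> \<le> B" using test_function_bounded[OF d] by blast
  have km: "case_prod ?k \<in> borel_measurable (unit_leb \<Otimes>\<^sub>M unit_leb)"
    using measurable_less_indicator
    by (auto simp: case_prod_beta intro!: borel_measurable_times)
  have "integrable (unit_leb \<Otimes>\<^sub>M unit_leb) (case_prod ?k)"
  proof (rule Bochner_Integration.integrable_bound[OF _ km])
    show "integrable (unit_leb \<Otimes>\<^sub>M unit_leb) (\<lambda>(t, x). f t * B)"
    proof (rule P.Fubini_integrable)
      show "integrable unit_leb (\<lambda>t. LINT x|unit_leb. norm (case (t, x) of (t, x) \<Rightarrow> f t * B))"
        using f by (simp add: measure_unit_leb_space)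
    qed auto
    show "AE p in unit_leb \<Otimes>\<^sub>M unit_leb. norm (case_prod ?k p) \<le> norm (case p of (t, x) \<Rightarrow> f t * B)"
    proof (intro AE_I2)
      fix p :: "real \<times> real"
      have "\<bar>deriv \<phi> (snd p) * indicator {..<snd p} (fst p)\<bar> \<le> \<bar>B\<bar>"
        using B[of "snd p"] by (auto simp: indicator_def)
      then show "norm (case_prod ?k p) \<le> norm (case p of (t, x) \<Rightarrow> f t * B)"
        by (auto simp: case_prod_beta abs_mult intro!: mult_left_mono)
    qed
  qed
  then have Fub: "(LINT x|unit_leb. LINT t|unit_leb. ?k t x) = (LINT t|unit_leb. LINT x|unit_leb. ?k t x)"
    by (rule P.Fubini_integral)
  have "(LINT x|unit_leb. f x * \<phi> x) = - (LINT t|unit_leb. LINT x|unit_leb. ?k t x)"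
    unfolding Bochner_Integration.integral_minus[symmetric]
    by (intro Bochner_Integration.integral_cong) (auto simp: tail space_restrict_space)
  also have "\<dots> = - (LINT x|unit_leb. LINT t|unit_leb. ?k t x)" by (simp only: Fub)
  also have "(LINT x|unit_leb. LINT t|unit_leb. ?k t x) = (LINT x|unit_leb. primitive f x * deriv \<phi> x)"
  proof (intro Bochner_Integration.integral_cong refl)
    fix x assume "x \<in> space unit_leb"
    then have "primitive f x * deriv \<phi> x = (LINT t|unit_leb. (f t * indicator {..<x} t) * deriv \<phi> x)"
      by (simp add: primitive_eq space_restrict_space)
    then show "(LINT t|unit_leb. ?k t x) = primitive f x * deriv \<phi> x"
      by (simp add: mult_ac)
  qed
  finally show ?thesis .
qed

lemma primitive_bound_closed:
  assumes "integrable unit_leb f" "x \<in> {0..1}"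
  shows "\<bar>primitive f x\<bar> \<le> (LINT t|unit_leb. \<bar>f t\<bar>)"
proof -
  consider "x = 0" | "x = 1" | "x \<in> {0<..<1}" using assms(2) by fastforce
  then show ?thesis
  proof cases
    case 1
    have "primitive f 0 = (LINT t|lebesgue. indicator {} t *\<^sub>R f t)"
      unfolding primitive_def by (subst integral_restrict_space) auto
    then have "primitive f x = 0" using 1 by simp
    then show ?thesis by simp
  next
    case 2
    then show ?thesis unfolding primitive_def by (simp add: integral_abs_bound)
  next
    case 3
    then show ?thesis by (rule primitive_bound[OF assms(1)])
  qed
qed

lemma primitive_between:
  assumes "integrable unit_leb f" "x \<in> {0..1}"
  shows "primitive_min f \<le> primitive f x" "primitive f x \<le> primitive_max f"
proof -
  have B: "primitive f t \<le> (LINT t|unit_leb. \<bar>f t\<bar>)" "- (LINT t|unit_leb. \<bar>f t\<bar>) \<le> primitive f t"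
    if "t \<in> {0..1}" for t
    using primitive_bound_closed[OF assms(1) that] by linarith+
  show "primitive_min f \<le> primitive f x"
    unfolding primitive_min_def by (rule cINF_lower[OF bdd_belowI2[OF B(2)] assms(2)])
  show "primitive f x \<le> primitive_max f"
    unfolding primitive_max_def by (rule cSUP_upper[OF assms(2) bdd_aboveI2[OF B(1)]])
qed

section \<open>Square integrable functions and weak derivatives\<close>
lemma Lp_space_2_iff:
  "g \<in> Lp_space 2 \<longleftrightarrow> g \<in> borel_measurable unit_leb \<and> integrable unit_leb (\<lambda>x. (g x)\<^sup>2)"
  by (simp add: Lp_space_def)

lemma Lp_norm_2: "Lp_norm 2 g = sqrt (LINT x|unit_leb. (g x)\<^sup>2)"
  by (simp add: Lp_norm_def powr_half_sqrt)

lemma Lp_norm_2_square: "(Lp_norm 2 g)\<^sup>2 = (LINT x|unit_leb. (g x)\<^sup>2)"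
  by (simp add: Lp_norm_2)

lemma Lp_norm_nonneg: "0 \<le> Lp_norm p g"
  by (simp add: Lp_norm_def)

lemma Lp_space_2_integrable:
  assumes "g \<in> Lp_space 2" shows "integrable unit_leb g"
proof (rule Bochner_Integration.integrable_bound)
  show "integrable unit_leb (\<lambda>x. 1 + (g x)\<^sup>2)" using assms by (simp add: Lp_space_2_iff)
  show "g \<in> borel_measurable unit_leb" using assms by (simp add: Lp_space_2_iff)
  have "\<bar>t\<bar> \<le> 1 + t\<^sup>2" for t :: real
    using zero_le_power2[of "\<bar>t\<bar> - 1"] by (simp add: power2_diff)
  then show "AE x in unit_leb. norm (g x) \<le> norm (1 + (g x)\<^sup>2)" by simp
qed

lemma Lp_space_2_diff:
  assumes "g \<in> Lp_space 2" "h \<in> Lp_space 2" shows "(\<lambda>x. g x - h x) \<in> Lp_space 2"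
  unfolding Lp_space_2_iff
proof
  have [measurable]: "g \<in> borel_measurable unit_leb" "h \<in> borel_measurable unit_leb"
    using assms by (auto simp: Lp_space_2_iff)
  show "(\<lambda>x. g x - h x) \<in> borel_measurable unit_leb" by measurable
  show "integrable unit_leb (\<lambda>x. (g x - h x)\<^sup>2)"
  proof (rule Bochner_Integration.integrable_bound)
    show "integrable unit_leb (\<lambda>x. 2 * (g x)\<^sup>2 + 2 * (h x)\<^sup>2)"
      using assms by (simp add: Lp_space_2_iff)
    have "(s - t)\<^sup>2 \<le> 2 * s\<^sup>2 + 2 * t\<^sup>2" for s t :: real
      using zero_le_power2[of "s + t"] by (simp add: power2_diff power2_sum)
    then show "AE x in unit_leb. norm ((g x - h x)\<^sup>2) \<le> norm (2 * (g x)\<^sup>2 + 2 * (h x)\<^sup>2)" by simp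
  qed measurable
qed

text \<open>
The variance of \<open>g\<close> under the uniform distribution is nonnegative.
\<close>
lemma abs_LINT_le_Lp_norm_2:
  assumes g: "g \<in> Lp_space 2"
  shows "\<bar>LINT x|unit_leb. g x\<bar> \<le> Lp_norm 2 g"
proof -
  define m where "m = (LINT x|unit_leb. g x)"
  have i: "integrable unit_leb (\<lambda>x. (g x)\<^sup>2)" "integrable unit_leb g"
    using g Lp_space_2_integrable[OF g] by (auto simp: Lp_space_2_iff)
  have i2: "integrable unit_leb (\<lambda>x. m\<^sup>2 - 2 * m * g x)" using i(2) by simp
  have "0 \<le> (LINT x|unit_leb. (g x - m)\<^sup>2)" by simp
  also have "\<dots> = (LINT x|unit_leb. (g x)\<^sup>2 + (m\<^sup>2 - 2 * m * g x))"
    by (simp add: power2_diff algebra_simps)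
  also have "\<dots> = (LINT x|unit_leb. (g x)\<^sup>2) + (m\<^sup>2 - 2 * m * m)"
  proof -
    have "(LINT x|unit_leb. m\<^sup>2 - 2 * m * g x) = m\<^sup>2 - 2 * m * m"
      using i(2) by (simp add: measure_unit_leb_space flip: m_def)
    then show ?thesis by (simp only: Bochner_Integration.integral_add[OF i(1) i2])
  qed
  finally have "m\<^sup>2 \<le> (Lp_norm 2 g)\<^sup>2" by (subst Lp_norm_2_square) (simp add: power2_eq_square)
  then show ?thesis unfolding m_def by (metis Lp_norm_nonneg abs_le_square_iff abs_of_nonneg)
qed

lemma Lp_space_2_test_function:
  assumes "\<phi> \<in> test_functions" shows "\<phi> \<in> Lp_space 2"
  using integrable_mult_test_function[OF integrable_test_function[OF assms] assms]
  by (simp add: Lp_space_2_iff test_function_measurable[OF assms] power2_eq_square)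

lemma H1_deriv_test_function:
  assumes \<phi>: "\<phi> \<in> test_functions" shows "H1_deriv \<phi> (deriv \<phi>)"
  unfolding H1_deriv_def
proof (intro conjI ballI)
  show "\<phi> \<in> Lp_space 2" "deriv \<phi> \<in> Lp_space 2"
    by (intro Lp_space_2_test_function test_function_deriv \<phi>)+
  fix \<psi> assume \<psi>: "\<psi> \<in> test_functions"
  have "((\<lambda>x. \<phi> x * \<psi> x) has_real_derivative deriv \<phi> x * \<psi> x + deriv \<psi> x * \<phi> x) (at x)" for x
    using \<phi> \<psi> by (intro DERIV_mult smooth_fun_DERIV) (auto simp: test_functions_iff)
  then have "deriv (\<lambda>x. \<phi> x * \<psi> x) = (\<lambda>x. deriv \<phi> x * \<psi> x + deriv \<psi> x * \<phi> x)"
    using DERIV_imp_deriv by blast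
  then have "0 = (LINT x|unit_leb. deriv \<phi> x * \<psi> x + deriv \<psi> x * \<phi> x)"
    using LINT_deriv_test_function[OF test_function_mult[OF \<phi> \<psi>]] by simp
  also have "\<dots> = (LINT x|unit_leb. deriv \<phi> x * \<psi> x) + (LINT x|unit_leb. deriv \<psi> x * \<phi> x)"
    by (rule Bochner_Integration.integral_add)
       (intro integrable_mult_test_function integrable_test_function test_function_deriv \<phi> \<psi>)+
  finally show "(LINT x|unit_leb. \<phi> x * deriv \<psi> x) = - (LINT x|unit_leb. deriv \<phi> x * \<psi> x)"
    by (simp add: mult.commute)
qed

lemma H10_test_function:
  assumes "\<phi> \<in> test_functions" shows "\<phi> \<in> H10"
  unfolding H10_def
  using assms H1_deriv_test_function[OF assms]
  by (auto intro!: exI[of _ "deriv \<phi>"] exI[of _ "\<lambda>_. \<phi>"] simp: Lp_norm_2)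

lemma H1_deriv_unique:
  assumes "H1_deriv u v" "H1_deriv u w"
  shows "AE x in unit_leb. v x = w x"
proof -
  have i: "integrable unit_leb v" "integrable unit_leb w"
    using assms by (auto simp: H1_deriv_def intro: Lp_space_2_integrable)
  have "AE x in unit_leb. v x - w x = 0"
  proof (rule fundamental_lemma)
    show "integrable unit_leb (\<lambda>x. v x - w x)" using i by simp
    fix \<phi> assume \<phi>: "\<phi> \<in> test_functions"
    have "(LINT x|unit_leb. (v x - w x) * \<phi> x) = (LINT x|unit_leb. v x * \<phi> x) - (LINT x|unit_leb. w x * \<phi> x)"
      using integrable_mult_test_function[OF _ \<phi>] i
      by (simp add: left_diff_distrib Bochner_Integration.integral_diff)
    also have "\<dots> = 0"
      using assms \<phi> unfolding H1_deriv_def by (metis (no_types, lifting) diff_self neg_equal_iff_equal)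
    finally show "(LINT x|unit_leb. (v x - w x) * \<phi> x) = 0" .
  qed
  then show ?thesis by eventually_elim simp
qed

text \<open>
This is how the boundary condition enters: the derivatives of test functions have mean zero, and the
mean is continuous in the \<open>L\<^sub>2\<close> norm.
\<close>
lemma H10_LINT_deriv:
  assumes "u \<in> H10" "H1_deriv u u'"
  shows "(LINT x|unit_leb. u' x) = 0"
proof -
  obtain v \<phi> where v: "H1_deriv u v" and \<phi>: "\<And>n::nat. \<phi> n \<in> test_functions"
    and lim: "(\<lambda>n. Lp_norm 2 (\<lambda>x. deriv (\<phi> n) x - v x)) \<longlonglongrightarrow> 0"
    using assms(1) unfolding H10_def by blast
  have v2: "v \<in> Lp_space 2" using v by (simp add: H1_deriv_def)
  have "\<bar>LINT x|unit_leb. v x\<bar> \<le> Lp_norm 2 (\<lambda>x. deriv (\<phi> n) x - v x)" for n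
  proof -
    have d: "deriv (\<phi> n) \<in> test_functions" by (rule test_function_deriv[OF \<phi>])
    have "(LINT x|unit_leb. deriv (\<phi> n) x - v x) = - (LINT x|unit_leb. v x)"
      using Bochner_Integration.integral_diff[OF integrable_test_function[OF d] Lp_space_2_integrable[OF v2]]
        LINT_deriv_test_function[OF \<phi>, of n] by simp
    then show ?thesis
      using abs_LINT_le_Lp_norm_2[OF Lp_space_2_diff[OF Lp_space_2_test_function[OF d] v2]] by simp
  qed
  then have "\<bar>LINT x|unit_leb. v x\<bar> \<le> 0"
    by (intro LIMSEQ_le_const[OF lim]) auto
  moreover have "(LINT x|unit_leb. u' x) = (LINT x|unit_leb. v x)"
    using H1_deriv_unique[OF assms(2) v] v assms(2)
    by (intro integral_cong_AE) (auto simp: H1_deriv_def Lp_space_def)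
  ultimately show ?thesis by simp
qed

section \<open>The flux of a weak solution\<close>
text \<open>
In one dimension the equation can be integrated once: \<open>a u' + F\<close> is orthogonal to the derivative of
every test function, so it is constant.
\<close>
lemma weak_solution_flux:
  assumes a: "a \<in> admissible lam Lam" and f: "integrable unit_leb f" and u: "weak_solution a f u u'"
  obtains M where "AE x in unit_leb. a x * u' x = M - primitive f x"
proof -
  have u': "integrable unit_leb u'"
    using u by (auto simp: weak_solution_def H1_deriv_def intro: Lp_space_2_integrable)
  have am: "a \<in> borel_measurable unit_leb" using a by (simp add: admissible_def)
  have "AE x in unit_leb. lam \<le> a x \<and> a x \<le> Lam" using a by (simp add: admissible_def)
  then have ab: "AE x in unit_leb. \<bar>a x\<bar> \<le> \<bar>lam\<bar> + \<bar>Lam\<bar>" by eventually_elim auto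
  have au: "integrable unit_leb (\<lambda>x. a x * u' x)"
    using integrable_mult_bounded[OF u' am ab] by (simp add: mult.commute)
  have F: "integrable unit_leb (primitive f)"
    by (rule integrable_bounded[OF primitive_measurable[OF f], where B = "LINT t|unit_leb. \<bar>f t\<bar>"])
       (use primitive_bound[OF f] in \<open>auto simp: space_restrict_space\<close>)
  obtain M where "AE x in unit_leb. a x * u' x + primitive f x = M"
  proof (rule du_Bois_Reymond)
    show "integrable unit_leb (\<lambda>x. a x * u' x + primitive f x)" using au F by simp
    fix \<phi> assume \<phi>: "\<phi> \<in> test_functions"
    have d: "deriv \<phi> \<in> test_functions" by (rule test_function_deriv[OF \<phi>])
    have "(LINT x|unit_leb. a x * u' x * deriv \<phi> x) = (LINT x|unit_leb. f x * \<phi> x)"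
      using u H10_test_function[OF \<phi>] H1_deriv_test_function[OF \<phi>] by (auto simp: weak_solution_def)
    also have "\<dots> = - (LINT x|unit_leb. primitive f x * deriv \<phi> x)"
      by (rule primitive_integration_by_parts[OF f \<phi>])
    finally show "(LINT x|unit_leb. (a x * u' x + primitive f x) * deriv \<phi> x) = 0"
      using integrable_mult_test_function[OF au d] integrable_mult_test_function[OF F d]
      by (simp add: distrib_right)
  qed
  then show ?thesis by (intro that[of M]) (auto elim: eventually_mono)
qed

lemma level_band_sets:
  assumes "integrable unit_leb f"
  shows "level_band f \<rho> M \<in> sets unit_leb" "level_band f \<rho> M \<in> sets lebesgue"
proof -
  note [measurable] = primitive_measurable[OF assms]
  have "level_band f \<rho> M = {x \<in> space unit_leb. \<bar>primitive f x - M\<bar> \<le> \<rho>}"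
    by (auto simp: level_band_def space_restrict_space)
  also have "\<dots> \<in> sets unit_leb" by measurable
  finally show s: "level_band f \<rho> M \<in> sets unit_leb" .
  then show "level_band f \<rho> M \<in> sets lebesgue" by (simp add: sets_restrict_space_iff)
qed

lemma measure_level_band:
  assumes "integrable unit_leb f"
  shows "measure lebesgue (level_band f \<rho> M) = measure unit_leb (level_band f \<rho> M)"
  using level_band_sets[OF assms] by (subst measure_restrict_space) (auto simp: level_band_def)

lemma measure_level_band_le_1:
  assumes "integrable unit_leb f"
  shows "measure lebesgue (level_band f \<rho> M) \<le> 1"
  using unit_leb.bounded_measure measure_unit_leb_space by (simp add: measure_level_band[OF assms])

lemma level_band_bounds:
  assumes f: "integrable unit_leb f" and N: "N \<in> {primitive_min f<..<primitive_max f}"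
    and low: "c \<le> (INF M\<in>{primitive_min f<..<primitive_max f}. measure lebesgue (level_band f \<rho> M))"
    and up: "(SUP M\<in>{primitive_min f<..<primitive_max f}. measure lebesgue (level_band f \<rho> M)) \<le> d"
  shows "c \<le> measure unit_leb (level_band f \<rho> N)" "measure unit_leb (level_band f \<rho> N) \<le> d"
proof -
  let ?m = "\<lambda>M. measure lebesgue (level_band f \<rho> M)"
  have "bdd_below (?m ` {primitive_min f<..<primitive_max f})" by (rule bdd_belowI2[where m = 0]) simp
  from cINF_lower[OF this N] low show "c \<le> measure unit_leb (level_band f \<rho> N)"
    by (simp add: measure_level_band[OF f])
  have "bdd_above (?m ` {primitive_min f<..<primitive_max f})"
    by (rule bdd_aboveI2[where M = 1]) (rule measure_level_band_le_1[OF f])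
  from cSUP_upper[OF N this] up show "measure unit_leb (level_band f \<rho> N) \<le> d"
    by (simp add: measure_level_band[OF f])
qed

text \<open>
If the flux constant were outside the open range of \<open>F\<close>, the flux and with it \<open>u'\<close> would have
constant sign. As \<open>u'\<close> has mean zero, it would vanish, and \<open>F\<close> would equal the flux constant almost
everywhere. This is impossible since the bands around the middle of the range of \<open>F\<close> have positive
measure. The result matters because the bands are only controlled for levels in the open range.
\<close>
lemma flux_constant_range:
  assumes f: "integrable unit_leb f" and ne: "primitive_min f < primitive_max f"
    and lam: "0 < lam" and a: "a \<in> admissible lam Lam"
    and u: "weak_solution a f u u'" and M: "AE x in unit_leb. a x * u' x = M - primitive f x"
    and \<rho>0: "0 < \<rho>0"
    and pos: "\<And>\<rho> N. 0 < \<rho> \<Longrightarrow> \<rho> \<le> \<rho>0 \<Longrightarrow> N \<in> {primitive_min f<..<primitive_max f} \<Longrightarrow>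
        0 < measure unit_leb (level_band f \<rho> N)"
  shows "M \<in> {primitive_min f<..<primitive_max f}"
proof (rule ccontr)
  assume out: "M \<notin> {primitive_min f<..<primitive_max f}"
  have u': "integrable unit_leb u'" and u0: "(LINT x|unit_leb. u' x) = 0"
    using u by (auto simp: weak_solution_def H1_deriv_def intro: Lp_space_2_integrable H10_LINT_deriv)
  have apos: "AE x in unit_leb. 0 < a x"
    using a lam by (auto simp: admissible_def elim: eventually_mono)
  have sp: "AE x in unit_leb. x \<in> {0..1}" by (intro AE_I2) (auto simp: space_restrict_space)
  have "AE x in unit_leb. u' x = 0"
  proof (cases "primitive_max f \<le> M")
    case True
    have "AE x in unit_leb. 0 \<le> u' x"
      using M apos sp
    proof eventually_elim
      case (elim x)
      then have "0 \<le> a x * u' x" using primitive_between(2)[OF f, of x] True by auto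
      then show ?case using elim(2) mult_le_cancel_left_pos[of "a x" 0 "u' x"] by simp
    qed
    then show ?thesis using integral_nonneg_eq_0_iff_AE[OF u'] u0 by simp
  next
    case False
    have "AE x in unit_leb. 0 \<le> - u' x"
      using M apos sp
    proof eventually_elim
      case (elim x)
      then have "a x * u' x \<le> 0" using primitive_between(1)[OF f, of x] False out by auto
      then show ?case using elim(2) mult_le_cancel_left_pos[of "a x" "u' x" 0] by simp
    qed
    then show ?thesis using integral_nonneg_eq_0_iff_AE[of unit_leb "\<lambda>x. - u' x"] u' u0 by simp
  qed
  then have FM: "AE x in unit_leb. primitive f x = M" using M by eventually_elim simp
  define N where "N = (primitive_min f + primitive_max f) / 2"
  define \<rho> where "\<rho> = min \<rho>0 ((primitive_max f - primitive_min f) / 4)"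
  have "N \<in> {primitive_min f<..<primitive_max f}" "0 < \<rho>" "\<rho> \<le> \<rho>0" "\<rho> < \<bar>M - N\<bar>"
    using ne out \<rho>0 unfolding N_def \<rho>_def by (auto simp: min_def abs_if field_simps)
  then have "AE x in unit_leb. x \<notin> level_band f \<rho> N" and p: "0 < measure unit_leb (level_band f \<rho> N)"
    using FM pos by (auto simp: level_band_def elim: eventually_mono)
  then have "level_band f \<rho> N \<in> null_sets unit_leb"
    using level_band_sets(1)[OF f] AE_iff_null_sets by blast
  then show False using p by (auto simp: measure_def null_sets_def)
qed

section \<open>Comparing two coefficients through their fluxes\<close>
lemma powr_add_le:
  fixes s t p :: real
  assumes "0 \<le> s" "0 \<le> t" "0 \<le> p"
  shows "(s + t) powr p \<le> 2 powr p * (s powr p + t powr p)"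
proof -
  have "(s + t) powr p \<le> (2 * max s t) powr p"
    using assms by (intro powr_mono2) auto
  also have "\<dots> = 2 powr p * (max s t) powr p" by (rule powr_mult)
  also have "\<dots> \<le> 2 powr p * (s powr p + t powr p)"
    by (intro mult_left_mono) (auto simp: max_def)
  finally show ?thesis .
qed

text \<open>
Young's inequality in a form that bounds the integral of \<open>w powr p\<close> by \<open>2 * y powr p\<close> whenever
\<open>y\<close> is at least the \<open>L\<^sub>2\<close> norm of \<open>w\<close>.
\<close>
lemma powr_le_interpolation:
  fixes w y p :: real
  assumes "0 \<le> w" "0 < y" "0 \<le> p" "p \<le> 2"
  shows "w powr p \<le> y powr p + y powr (p - 2) * w\<^sup>2"
proof (cases "w \<le> y")
  case True
  then have "w powr p \<le> y powr p" using assms by (intro powr_mono2) auto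
  then show ?thesis by (simp add: add_increasing2)
next
  case False
  then have w: "0 < w" using assms by simp
  have "w powr p = w powr (p - 2) * w powr 2" by (simp flip: powr_add)
  also have "w powr 2 = w\<^sup>2" using w by simp
  also have "w powr (p - 2) \<le> y powr (p - 2)"
    using False assms by (intro powr_mono2') auto
  finally have "w powr p \<le> y powr (p - 2) * w\<^sup>2" by (simp add: mult_right_mono)
  then show ?thesis by (simp add: add_increasing)
qed

text \<open>
The flux identities are all that the comparison has to know about the two solutions.
\<close>
locale flux_pair =
  fixes lam Lam :: real and f a b u' v' :: "real \<Rightarrow> real" and M N :: real
  assumes lam: "0 < lam" and lam_Lam: "lam < Lam"
    and a: "a \<in> admissible lam Lam" and b: "b \<in> admissible lam Lam"
    and f: "integrable unit_leb f"
    and u': "u' \<in> Lp_space 2" and v': "v' \<in> Lp_space 2"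
    and M: "AE x in unit_leb. a x * u' x = M - primitive f x"
    and N: "AE x in unit_leb. b x * v' x = N - primitive f x"
begin

abbreviation "w x \<equiv> u' x - v' x"
abbreviation "\<delta> \<equiv> Lp_norm 2 (\<lambda>x. u' x - v' x)"

lemma Lam_pos: "0 < Lam" using lam lam_Lam by simp

lemma ab_measurable [measurable]: "a \<in> borel_measurable unit_leb" "b \<in> borel_measurable unit_leb"
  using a b by (auto simp: admissible_def)

lemma w_square: "integrable unit_leb (\<lambda>x. (w x)\<^sup>2)" "(LINT x|unit_leb. (w x)\<^sup>2) = \<delta>\<^sup>2"
  using Lp_space_2_diff[OF u' v'] by (auto simp: Lp_space_2_iff Lp_norm_2_square)

lemma pointwise_flux:
  "AE x in unit_leb. lam \<le> a x \<and> a x \<le> Lam \<and> lam \<le> b x \<and> b x \<le> Lam \<and>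
     a x * u' x = M - primitive f x \<and> b x * v' x = N - primitive f x \<and> x \<in> {0<..<1}"
proof -
  have "AE x in unit_leb. x \<in> {0<..<1}" by (intro AE_I2) (simp add: space_restrict_space)
  moreover have "AE x in unit_leb. lam \<le> a x \<and> a x \<le> Lam" "AE x in unit_leb. lam \<le> b x \<and> b x \<le> Lam"
    using a b by (auto simp: admissible_def)
  ultimately show ?thesis using M N by eventually_elim blast
qed

text \<open>
On a narrow band around \<open>N\<close> the second flux is small while the first one is still about
\<open>\<bar>M - N\<bar>\<close>, so the gradients differ by a multiple of \<open>\<bar>M - N\<bar>\<close>. The bound on \<open>c\<close> makes
\<open>Lam * \<bar>v' x\<bar>\<close> at most a quarter of the gap and \<open>Lam * \<bar>u' x\<bar>\<close> at least three quarters of it.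
\<close>
lemma gradient_gap:
  assumes c: "0 \<le> c" "c \<le> lam / (4 * Lam)"
  shows "AE x in unit_leb. x \<in> level_band f (c * \<bar>M - N\<bar>) N \<longrightarrow> \<bar>M - N\<bar> / (2 * Lam) \<le> \<bar>w x\<bar>"
  using pointwise_flux
proof eventually_elim
  case (elim x)
  define D where "D = \<bar>M - N\<bar>"
  show ?case
  proof
    assume "x \<in> level_band f (c * \<bar>M - N\<bar>) N"
    then have K: "\<bar>N - primitive f x\<bar> \<le> c * D" by (simp add: level_band_def D_def abs_minus_commute)
    have D: "0 \<le> D" by (simp add: D_def)
    have "c * Lam \<le> lam / 4" using c Lam_pos by (simp add: field_simps)
    moreover have "c * lam \<le> c * Lam" using c lam_Lam by (intro mult_left_mono) auto
    ultimately have "c * lam \<le> 1 / 4 * lam" by linarith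
    then have c4: "c \<le> 1 / 4" using lam by (simp only: mult_le_cancel_right_pos)
    have "lam * \<bar>v' x\<bar> \<le> b x * \<bar>v' x\<bar>" using elim by (intro mult_right_mono) auto
    also have "\<dots> = \<bar>N - primitive f x\<bar>" using elim lam by (metis abs_mult abs_of_pos less_le_trans)
    also have "\<dots> \<le> c * D" by (rule K)
    finally have v: "lam * \<bar>v' x\<bar> \<le> c * D" .
    have "Lam * (lam * \<bar>v' x\<bar>) \<le> Lam * (c * D)" using v Lam_pos by (intro mult_left_mono) auto
    also have "\<dots> = (c * Lam) * D" by simp
    also have "\<dots> \<le> (lam / 4) * D" by (rule mult_right_mono) fact+
    finally have "lam * (Lam * \<bar>v' x\<bar>) \<le> lam * (D / 4)" by (simp add: algebra_simps)
    then have v: "Lam * \<bar>v' x\<bar> \<le> D / 4" using lam by (simp only: mult_le_cancel_left_pos)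
    have "D \<le> \<bar>M - primitive f x\<bar> + \<bar>N - primitive f x\<bar>" unfolding D_def by linarith
    also have "\<bar>M - primitive f x\<bar> = a x * \<bar>u' x\<bar>" using elim lam by (metis abs_mult abs_of_pos less_le_trans)
    also have "\<dots> \<le> Lam * \<bar>u' x\<bar>" using elim by (intro mult_right_mono) auto
    also have "\<bar>N - primitive f x\<bar> \<le> (1 / 4) * D" using K mult_right_mono[OF c4 D] by linarith
    finally have u: "(3 / 4) * D \<le> Lam * \<bar>u' x\<bar>" by simp
    have "Lam * (\<bar>u' x\<bar> - \<bar>v' x\<bar>) \<le> Lam * \<bar>w x\<bar>"
      using Lam_pos abs_triangle_ineq2 by (intro mult_left_mono) auto
    with u v have "D / 2 \<le> Lam * \<bar>w x\<bar>" by (simp add: right_diff_distrib)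
    then show "\<bar>M - N\<bar> / (2 * Lam) \<le> \<bar>w x\<bar>" using Lam_pos by (simp add: field_simps D_def)
  qed
qed

lemma flux_gap_band:
  assumes c: "0 \<le> c" "c \<le> lam / (4 * Lam)"
  shows "(\<bar>M - N\<bar> / (2 * Lam))\<^sup>2 * measure unit_leb (level_band f (c * \<bar>M - N\<bar>) N) \<le> \<delta>\<^sup>2"
proof -
  let ?K = "level_band f (c * \<bar>M - N\<bar>) N"
  have K: "?K \<in> sets unit_leb" by (rule level_band_sets[OF f])
  have "(\<bar>M - N\<bar> / (2 * Lam))\<^sup>2 * measure unit_leb ?K
      = (LINT x|unit_leb. (\<bar>M - N\<bar> / (2 * Lam))\<^sup>2 * indicator ?K x)"
    using K sets.Int_space_eq2[OF K] by simp
  also have "\<dots> \<le> (LINT x|unit_leb. (w x)\<^sup>2)"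
  proof (rule integral_mono_AE)
    show "integrable unit_leb (\<lambda>x. (\<bar>M - N\<bar> / (2 * Lam))\<^sup>2 * indicator ?K x)"
      using K by (intro integrable_mult_right integrable_real_indicator) (auto simp: less_top[symmetric])
    show "AE x in unit_leb. (\<bar>M - N\<bar> / (2 * Lam))\<^sup>2 * indicator ?K x \<le> (w x)\<^sup>2"
      using gradient_gap[OF c]
    proof eventually_elim
      case (elim x)
      show ?case
      proof (cases "x \<in> ?K")
        case True
        then have "\<bar>M - N\<bar> / (2 * Lam) \<le> \<bar>w x\<bar>" using elim by blast
        then have "(\<bar>M - N\<bar> / (2 * Lam))\<^sup>2 \<le> \<bar>w x\<bar>\<^sup>2"
          using Lam_pos by (intro power_mono) auto
        then show ?thesis using True by simp
      qed simp
    qed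
  qed (rule w_square)
  finally show ?thesis by (simp only: w_square(2))
qed

text \<open>
The lower bound on the measure of bands, applied to a band whose width is itself proportional to
\<open>\<bar>M - N\<bar>\<close>, turns the previous estimate into \<open>\<bar>M - N\<bar> powr (2 + \<alpha>) \<le> G * \<delta>\<^sup>2\<close>. The factor \<open>\<rho>0 / R\<close>
keeps the width in the range in which the lower bound holds.
\<close>
lemma flux_gap:
  assumes C1: "0 < C1" and \<alpha>: "0 \<le> \<alpha>" and \<rho>0: "0 < \<rho>0" and R: "0 < R" "\<bar>M - N\<bar> \<le> R"
    and low: "\<And>\<rho>. 0 < \<rho> \<Longrightarrow> \<rho> \<le> \<rho>0 \<Longrightarrow> C1 * \<rho> powr \<alpha> \<le> measure unit_leb (level_band f \<rho> N)"
  shows "\<bar>M - N\<bar> \<le> (4 * Lam\<^sup>2 / (C1 * (min (lam / (4 * Lam)) (\<rho>0 / R)) powr \<alpha>)) powr (1 / (2 + \<alpha>))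
      * \<delta> powr (2 / (2 + \<alpha>))"
proof (cases "M = N")
  case False
  define D where "D = \<bar>M - N\<bar>"
  define c where "c = min (lam / (4 * Lam)) (\<rho>0 / R)"
  have D: "0 < D" using False by (simp add: D_def)
  have c: "0 < c" "c \<le> lam / (4 * Lam)" "c \<le> \<rho>0 / R"
    using lam Lam_pos \<rho>0 R by (auto simp: c_def)
  have "c * D \<le> (\<rho>0 / R) * R" using c R D \<rho>0 by (intro mult_mono) (auto simp: D_def)
  then have "c * D \<le> \<rho>0" using R by simp
  then have "C1 * (c * D) powr \<alpha> \<le> measure unit_leb (level_band f (c * D) N)"
    using c D by (intro low) auto
  then have "(D / (2 * Lam))\<^sup>2 * (C1 * (c * D) powr \<alpha>)
      \<le> (D / (2 * Lam))\<^sup>2 * measure unit_leb (level_band f (c * D) N)"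
    by (intro mult_left_mono) auto
  also have "\<dots> \<le> \<delta>\<^sup>2" using flux_gap_band[of c] c by (simp add: D_def)
  finally have "(D / (2 * Lam))\<^sup>2 * (C1 * (c * D) powr \<alpha>) \<le> \<delta>\<^sup>2" .
  moreover have "(D / (2 * Lam))\<^sup>2 * (C1 * (c * D) powr \<alpha>)
      = D powr (2 + \<alpha>) * (C1 * c powr \<alpha>) / (4 * Lam\<^sup>2)"
    using D c by (simp add: powr_mult powr_add power2_eq_square field_simps)
  ultimately have "D powr (2 + \<alpha>) \<le> (4 * Lam\<^sup>2 / (C1 * c powr \<alpha>)) * \<delta>\<^sup>2"
    using C1 c Lam_pos by (simp add: field_simps)
  then have "(D powr (2 + \<alpha>)) powr (1 / (2 + \<alpha>)) \<le> ((4 * Lam\<^sup>2 / (C1 * c powr \<alpha>)) * \<delta>\<^sup>2) powr (1 / (2 + \<alpha>))"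
    using \<alpha> by (intro powr_mono2) auto
  also have "(D powr (2 + \<alpha>)) powr (1 / (2 + \<alpha>)) = D" using D \<alpha> by (simp add: powr_powr)
  also have "((4 * Lam\<^sup>2 / (C1 * c powr \<alpha>)) * \<delta>\<^sup>2) powr (1 / (2 + \<alpha>))
      = (4 * Lam\<^sup>2 / (C1 * c powr \<alpha>)) powr (1 / (2 + \<alpha>)) * (\<delta>\<^sup>2) powr (1 / (2 + \<alpha>))"
    by (rule powr_mult)
  also have "\<delta>\<^sup>2 = \<delta> powr 2" using Lp_norm_nonneg[of 2 "\<lambda>x. w x"] by simp
  also have "(\<delta> powr 2) powr (1 / (2 + \<alpha>)) = \<delta> powr (2 / (2 + \<alpha>))" by (simp add: powr_powr)
  finally show ?thesis by (simp add: D_def c_def)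
qed simp

lemma coefficient_bound: "AE x in unit_leb. \<bar>a x - b x\<bar> \<le> Lam"
  using pointwise_flux by eventually_elim (use lam in auto)

text \<open>
Subtracting the flux identities gives \<open>(a - b) v' = (M - N) - a (u' - v')\<close>, and \<open>v'\<close> is bounded away
from zero off the band.
\<close>
lemma coefficient_gap:
  assumes \<rho>: "0 < \<rho>"
  shows "AE x in unit_leb. x \<notin> level_band f \<rho> N \<longrightarrow> \<bar>a x - b x\<bar> \<le> Lam / \<rho> * (\<bar>M - N\<bar> + Lam * \<bar>w x\<bar>)"
  using pointwise_flux
proof eventually_elim
  case (elim x)
  show ?case
  proof
    assume "x \<notin> level_band f \<rho> N"
    then have "\<rho> \<le> \<bar>N - primitive f x\<bar>" using elim by (auto simp: level_band_def)
    also have "\<dots> = b x * \<bar>v' x\<bar>" using elim lam by (metis abs_mult abs_of_pos less_le_trans)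
    also have "\<dots> \<le> Lam * \<bar>v' x\<bar>" using elim by (intro mult_right_mono) auto
    finally have v: "\<rho> \<le> Lam * \<bar>v' x\<bar>" .
    have "(a x - b x) * v' x = (M - N) - a x * w x" using elim by (simp add: algebra_simps)
    then have "\<bar>a x - b x\<bar> * \<bar>v' x\<bar> \<le> \<bar>M - N\<bar> + \<bar>a x * w x\<bar>"
      unfolding abs_mult[symmetric] by simp
    also have "\<bar>a x * w x\<bar> \<le> Lam * \<bar>w x\<bar>"
      unfolding abs_mult using elim lam by (intro mult_right_mono) auto
    finally have "\<bar>a x - b x\<bar> * \<bar>v' x\<bar> \<le> \<bar>M - N\<bar> + Lam * \<bar>w x\<bar>" by simp
    then have "Lam * (\<bar>a x - b x\<bar> * \<bar>v' x\<bar>) \<le> Lam * (\<bar>M - N\<bar> + Lam * \<bar>w x\<bar>)"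
      using Lam_pos by (intro mult_left_mono) auto
    moreover have "\<bar>a x - b x\<bar> * \<rho> \<le> \<bar>a x - b x\<bar> * (Lam * \<bar>v' x\<bar>)"
      using v by (intro mult_left_mono) auto
    ultimately have "\<bar>a x - b x\<bar> * \<rho> \<le> Lam * (\<bar>M - N\<bar> + Lam * \<bar>w x\<bar>)" by (simp add: mult_ac)
    then show "\<bar>a x - b x\<bar> \<le> Lam / \<rho> * (\<bar>M - N\<bar> + Lam * \<bar>w x\<bar>)"
      using \<rho> by (simp add: pos_le_divide_eq)
  qed
qed

lemma integrable_coefficient_powr:
  assumes "0 \<le> p" shows "integrable unit_leb (\<lambda>x. \<bar>a x - b x\<bar> powr p)"
proof (rule integrable_bounded[where B = "Lam powr p"])
  show "AE x in unit_leb. \<bar>\<bar>a x - b x\<bar> powr p\<bar> \<le> Lam powr p"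
    using coefficient_bound by eventually_elim (use assms in \<open>auto intro: powr_mono2\<close>)
qed measurable

text \<open>
The coefficients are bounded on the band, which is small, and close to each other off the band.
Here \<open>y\<close> is any quantity that dominates \<open>\<delta>\<close> and, up to the factor \<open>\<Gamma>\<close>, the gap of the flux
constants; keeping it separate from \<open>\<delta>\<close> allows \<open>\<delta> = 0\<close>, where \<open>y\<close> is arbitrarily small but positive.
\<close>
lemma Lp_estimate_band:
  assumes p: "1 \<le> p" "p \<le> 2" and y: "0 < y" "\<delta> \<le> y" "\<bar>M - N\<bar> \<le> \<Gamma> * y" and \<Gamma>: "0 \<le> \<Gamma>" and \<rho>: "0 < \<rho>"
  shows "(LINT x|unit_leb. \<bar>a x - b x\<bar> powr p)
    \<le> Lam powr p * measure unit_leb (level_band f \<rho> N)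
      + (2 * Lam) powr p * (\<Gamma> powr p + 2 * Lam powr p) * (y powr p / \<rho> powr p)"
proof -
  let ?K = "level_band f \<rho> N"
  define T where "T = (2 * Lam) powr p / \<rho> powr p"
  define A where "A = T * (\<Gamma> powr p * y powr p + Lam powr p * y powr p)"
  define B where "B = T * (Lam powr p * y powr (p - 2))"
  have T: "0 \<le> T" by (simp add: T_def)
  have K: "?K \<in> sets unit_leb" by (rule level_band_sets[OF f])
  have iK: "integrable unit_leb (\<lambda>x. Lam powr p * indicator ?K x)"
    using K by (intro integrable_mult_right integrable_real_indicator) (auto simp: less_top[symmetric])
  have iw: "integrable unit_leb (\<lambda>x. A + B * (w x)\<^sup>2)"
    by (intro Bochner_Integration.integrable_add integrable_mult_right w_square(1)) simp
  have "(LINT x|unit_leb. \<bar>a x - b x\<bar> powr p)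
      \<le> (LINT x|unit_leb. Lam powr p * indicator ?K x + (A + B * (w x)\<^sup>2))"
  proof (rule integral_mono_AE[OF integrable_coefficient_powr Bochner_Integration.integrable_add[OF iK iw]])
    show "0 \<le> p" using p by simp
    show "AE x in unit_leb. \<bar>a x - b x\<bar> powr p \<le> Lam powr p * indicator ?K x + (A + B * (w x)\<^sup>2)"
      using coefficient_bound coefficient_gap[OF \<rho>]
    proof eventually_elim
      case (elim x)
      show ?case
      proof (cases "x \<in> ?K")
        case True
        have "\<bar>a x - b x\<bar> powr p \<le> Lam powr p" using elim p by (intro powr_mono2) auto
        moreover have "0 \<le> A + B * (w x)\<^sup>2" using T by (simp add: A_def B_def)
        ultimately show ?thesis using True by simp
      next
        case False
        have "\<bar>a x - b x\<bar> powr p \<le> (Lam / \<rho> * (\<bar>M - N\<bar> + Lam * \<bar>w x\<bar>)) powr p"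
          using elim False p by (intro powr_mono2) auto
        also have "\<dots> = (Lam / \<rho>) powr p * (\<bar>M - N\<bar> + Lam * \<bar>w x\<bar>) powr p"
          by (rule powr_mult)
        also have "\<dots> \<le> (Lam / \<rho>) powr p * (2 powr p * (\<bar>M - N\<bar> powr p + (Lam * \<bar>w x\<bar>) powr p))"
          using Lam_pos p by (intro mult_left_mono powr_add_le) auto
        also have "\<dots> = T * (\<bar>M - N\<bar> powr p + Lam powr p * \<bar>w x\<bar> powr p)"
          using Lam_pos \<rho> by (simp add: T_def powr_mult powr_divide)
        also have "\<dots> \<le> T * (\<Gamma> powr p * y powr p + Lam powr p * (y powr p + y powr (p - 2) * \<bar>w x\<bar>\<^sup>2))"
        proof (intro mult_left_mono add_mono T)
          have "\<bar>M - N\<bar> powr p \<le> (\<Gamma> * y) powr p" using y p by (intro powr_mono2) auto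
          then show "\<bar>M - N\<bar> powr p \<le> \<Gamma> powr p * y powr p" using \<Gamma> y by (simp add: powr_mult)
          show "\<bar>w x\<bar> powr p \<le> y powr p + y powr (p - 2) * \<bar>w x\<bar>\<^sup>2"
            using y p by (intro powr_le_interpolation) auto
        qed simp
        also have "\<dots> = A + B * (w x)\<^sup>2" by (simp add: A_def B_def algebra_simps)
        finally show ?thesis using False by simp
      qed
    qed
  qed
  also have "\<dots> = Lam powr p * measure unit_leb ?K + (A + B * \<delta>\<^sup>2)"
  proof -
    have "(LINT x|unit_leb. A + B * (w x)\<^sup>2) = A + B * \<delta>\<^sup>2"
      using w_square measure_unit_leb_space by (subst Bochner_Integration.integral_add) auto
    then show ?thesis using K sets.Int_space_eq2[OF K] by (simp add: Bochner_Integration.integral_add[OF iK iw])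
  qed
  also have "B * \<delta>\<^sup>2 \<le> B * y\<^sup>2"
    using y T Lp_norm_nonneg by (intro mult_left_mono power_mono) (auto simp: B_def)
  also have "B * y\<^sup>2 = T * (Lam powr p * y powr p)"
  proof -
    have "y powr p = y powr (p - 2) * y powr 2" by (simp flip: powr_add)
    then show ?thesis using y by (simp add: B_def)
  qed
  also have "Lam powr p * measure unit_leb ?K + (A + T * (Lam powr p * y powr p))
      = Lam powr p * measure unit_leb ?K
        + (2 * Lam) powr p * (\<Gamma> powr p + 2 * Lam powr p) * (y powr p / \<rho> powr p)"
    by (simp add: A_def T_def algebra_simps add_divide_distrib)
  finally show ?thesis by simp
qed

text \<open>
The width \<open>\<rho> = y powr (p / (p + \<beta>))\<close> balances the two contributions \<open>\<rho> powr \<beta>\<close> and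
\<open>(y / \<rho>) powr p\<close>.
\<close>
lemma Lp_norm_estimate:
  assumes p: "1 \<le> p" "p \<le> 2" and y: "0 < y" "\<delta> \<le> y" "\<bar>M - N\<bar> \<le> \<Gamma> * y" and \<Gamma>: "0 \<le> \<Gamma>"
    and \<beta>: "0 < \<beta>" and up: "\<And>\<rho>. 0 < \<rho> \<Longrightarrow> measure unit_leb (level_band f \<rho> N) \<le> C2 * \<rho> powr \<beta>"
  shows "Lp_norm p (\<lambda>x. a x - b x)
    \<le> (Lam powr p * C2 + (2 * Lam) powr p * (\<Gamma> powr p + 2 * Lam powr p)) powr (1 / p) * y powr (\<beta> / (p + \<beta>))"
proof -
  let ?G = "(2 * Lam) powr p * (\<Gamma> powr p + 2 * Lam powr p)"
  define \<rho> where "\<rho> = y powr (p / (p + \<beta>))"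
  have \<rho>: "0 < \<rho>" using y by (simp add: \<rho>_def)
  have C2: "0 \<le> C2" using order_trans[OF measure_nonneg up[of 1]] by simp
  have e: "p - p / (p + \<beta>) * p = p * \<beta> / (p + \<beta>)" using p \<beta> by (simp add: field_simps)
  have "y powr p / \<rho> powr p = y powr (p - p / (p + \<beta>) * p)"
    unfolding \<rho>_def powr_powr by (rule powr_diff[symmetric])
  then have 1: "y powr p / \<rho> powr p = y powr (p * \<beta> / (p + \<beta>))" by (simp only: e)
  have 2: "\<rho> powr \<beta> = y powr (p * \<beta> / (p + \<beta>))" unfolding \<rho>_def powr_powr by simp
  have "(LINT x|unit_leb. \<bar>a x - b x\<bar> powr p)
      \<le> Lam powr p * measure unit_leb (level_band f \<rho> N) + ?G * (y powr p / \<rho> powr p)"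
    by (rule Lp_estimate_band[OF p y \<Gamma> \<rho>])
  also have "\<dots> \<le> Lam powr p * (C2 * \<rho> powr \<beta>) + ?G * (y powr p / \<rho> powr p)"
    using up[OF \<rho>] by (intro add_right_mono mult_left_mono) auto
  also have "\<dots> = (Lam powr p * C2 + ?G) * y powr (p * \<beta> / (p + \<beta>))"
    unfolding 1 2 by (simp add: algebra_simps)
  finally have "Lp_norm p (\<lambda>x. a x - b x) \<le> ((Lam powr p * C2 + ?G) * y powr (p * \<beta> / (p + \<beta>))) powr (1 / p)"
    unfolding Lp_norm_def using p by (intro powr_mono2) auto
  also have "\<dots> = (Lam powr p * C2 + ?G) powr (1 / p) * (y powr (p * \<beta> / (p + \<beta>))) powr (1 / p)"
    by (rule powr_mult)
  also have "(y powr (p * \<beta> / (p + \<beta>))) powr (1 / p) = y powr (\<beta> / (p + \<beta>))"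
    using p by (simp add: powr_powr)
  finally show ?thesis .
qed

lemma Lp_norm_le_Lam:
  assumes "1 \<le> p" shows "Lp_norm p (\<lambda>x. a x - b x) \<le> Lam"
proof -
  have "(LINT x|unit_leb. \<bar>a x - b x\<bar> powr p) \<le> (LINT x|unit_leb. Lam powr p)"
  proof (rule integral_mono_AE[OF integrable_coefficient_powr])
    show "AE x in unit_leb. \<bar>a x - b x\<bar> powr p \<le> Lam powr p"
      using coefficient_bound by eventually_elim (use assms in \<open>auto intro: powr_mono2\<close>)
  qed (use assms in auto)
  then have "(LINT x|unit_leb. \<bar>a x - b x\<bar> powr p) \<le> Lam powr p" by (simp add: measure_unit_leb_space)
  then have "Lp_norm p (\<lambda>x. a x - b x) \<le> (Lam powr p) powr (1 / p)"
    unfolding Lp_norm_def using assms by (intro powr_mono2) auto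
  also have "\<dots> = Lam" using assms Lam_pos by (simp add: powr_powr)
  finally show ?thesis .
qed

lemma Lp_norm_le_L2:
  assumes p: "2 < p"
  shows "Lp_norm p (\<lambda>x. a x - b x) \<le> Lam powr ((p - 2) / p) * Lp_norm 2 (\<lambda>x. a x - b x) powr (2 / p)"
proof -
  let ?L = "Lp_norm 2 (\<lambda>x. a x - b x)"
  have i2: "integrable unit_leb (\<lambda>x. (a x - b x)\<^sup>2)" using integrable_coefficient_powr[of 2] by simp
  have "(LINT x|unit_leb. \<bar>a x - b x\<bar> powr p) \<le> (LINT x|unit_leb. Lam powr (p - 2) * (a x - b x)\<^sup>2)"
  proof (rule integral_mono_AE[OF integrable_coefficient_powr integrable_mult_right[OF i2]])
    show "AE x in unit_leb. \<bar>a x - b x\<bar> powr p \<le> Lam powr (p - 2) * (a x - b x)\<^sup>2"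
      using coefficient_bound
    proof eventually_elim
      case (elim x)
      have "\<bar>a x - b x\<bar> powr p = \<bar>a x - b x\<bar> powr (p - 2) * \<bar>a x - b x\<bar> powr 2"
        by (subst powr_add[symmetric]) simp
      also have "\<dots> \<le> Lam powr (p - 2) * \<bar>a x - b x\<bar> powr 2"
        using elim p by (intro mult_right_mono powr_mono2) auto
      finally show ?case by simp
    qed
  qed (use p in auto)
  also have "\<dots> = Lam powr (p - 2) * ?L powr 2"
    using Lp_norm_nonneg[of 2 "\<lambda>x. a x - b x"] Lp_norm_2_square[of "\<lambda>x. a x - b x"] by simp
  finally have "Lp_norm p (\<lambda>x. a x - b x) \<le> (Lam powr (p - 2) * ?L powr 2) powr (1 / p)"
    unfolding Lp_norm_def using p by (intro powr_mono2) auto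
  also have "\<dots> = Lam powr ((p - 2) / p) * ?L powr (2 / p)"
    by (simp add: powr_mult powr_powr)
  finally show ?thesis .
qed

end

section \<open>Hoelder stability of the coefficient\<close>
definition holder_stable :: "real \<Rightarrow> real \<Rightarrow> (real \<Rightarrow> real) \<Rightarrow> real \<Rightarrow> real \<Rightarrow> bool" where
  "holder_stable lam Lam f p s \<longleftrightarrow>
     (\<exists>C>0. \<forall>a\<in>admissible lam Lam. \<forall>b\<in>admissible lam Lam. \<forall>ua ua' ub ub'.
        weak_solution a f ua ua' \<and> weak_solution b f ub ub' \<longrightarrow>
        Lp_norm p (\<lambda>x. a x - b x) \<le> C * Lp_norm 2 (\<lambda>x. ua' x - ub' x) powr s)"

lemma flux_pair_exists:
  assumes "0 < lam" "lam < Lam" "integrable unit_leb f" "a \<in> admissible lam Lam" "b \<in> admissible lam Lam"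
    "weak_solution a f ua ua'" "weak_solution b f ub ub'"
  obtains M N where "flux_pair lam Lam f a b ua' ub' M N"
proof -
  obtain M where "AE x in unit_leb. a x * ua' x = M - primitive f x"
    by (rule weak_solution_flux[OF assms(4,3,6)])
  moreover obtain N where "AE x in unit_leb. b x * ub' x = N - primitive f x"
    by (rule weak_solution_flux[OF assms(5,3,7)])
  moreover have "ua' \<in> Lp_space 2" "ub' \<in> Lp_space 2"
    using assms(6,7) by (auto simp: weak_solution_def H1_deriv_def)
  ultimately have "flux_pair lam Lam f a b ua' ub' M N"
    using assms(1-5) by unfold_locales auto
  then show ?thesis by (rule that)
qed

lemma le_zero_if_le_powr:
  fixes L K e :: real
  assumes "\<And>y. 0 < y \<Longrightarrow> L \<le> K * y powr e" "0 < e"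
  shows "L \<le> 0"
proof -
  have "((\<lambda>y. K * y powr e) \<longlongrightarrow> K * 0 powr e) (at_right 0)"
    by (intro tendsto_mult tendsto_const tendsto_powr' tendsto_ident_at) (use assms(2) in \<open>auto simp: eventually_at_right_field intro!: exI[of _ 1]\<close>)
  then have "L \<le> K * 0 powr e"
    by (rule tendsto_lowerbound) (use assms in \<open>auto simp: eventually_at_right_field intro!: exI[of _ 1]\<close>)
  then show ?thesis by simp
qed

text \<open>
The estimate yields the largest admitted exponent, and any smaller one follows: for \<open>\<delta> < 1\<close> it gives a weaker claim, and for
\<open>\<delta> \<ge> 1\<close> the claim is trivial as the coefficients are bounded.
\<close>
lemma holder_stable_le_2:
  fixes lam Lam \<alpha> \<beta> C1 C2 \<rho>0 :: real
  assumes lam: "0 < lam" "lam < Lam" and f: "integrable unit_leb f" and ne: "primitive_min f < primitive_max f"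
    and \<alpha>: "0 \<le> \<alpha>" and \<beta>: "0 < \<beta>" and C1: "0 < C1" and C2: "0 < C2" and \<rho>0: "0 < \<rho>0"
    and low: "\<And>\<rho> N. 0 < \<rho> \<Longrightarrow> \<rho> \<le> \<rho>0 \<Longrightarrow> N \<in> {primitive_min f<..<primitive_max f} \<Longrightarrow>
        C1 * \<rho> powr \<alpha> \<le> measure unit_leb (level_band f \<rho> N)"
    and up: "\<And>\<rho> N. 0 < \<rho> \<Longrightarrow> \<rho> \<le> \<rho>0 \<Longrightarrow> N \<in> {primitive_min f<..<primitive_max f} \<Longrightarrow>
        measure unit_leb (level_band f \<rho> N) \<le> C2 * \<rho> powr \<beta>"
    and p: "1 \<le> p" "p \<le> 2" and s: "0 \<le> s" "s \<le> 2 * \<beta> / ((2 + \<alpha>) * (p + \<beta>))"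
  shows "holder_stable lam Lam f p s"
proof -
  \<comment> \<open>Bands have measure at most 1, so the upper bound extends to every positive width.\<close>
  define C2' where "C2' = max C2 (1 / \<rho>0 powr \<beta>)"
  have up': "measure unit_leb (level_band f \<rho> N) \<le> C2' * \<rho> powr \<beta>"
    if "0 < \<rho>" "N \<in> {primitive_min f<..<primitive_max f}" for \<rho> N
  proof (cases "\<rho> \<le> \<rho>0")
    case True
    have "C2 * \<rho> powr \<beta> \<le> C2' * \<rho> powr \<beta>" by (intro mult_right_mono) (auto simp: C2'_def)
    then show ?thesis using up[OF that(1) True that(2)] by linarith
  next
    case False
    have "measure unit_leb (level_band f \<rho> N) \<le> 1"
      using measure_level_band_le_1[OF f] by (simp add: measure_level_band[OF f])
    also have "1 \<le> (1 / \<rho>0 powr \<beta>) * \<rho> powr \<beta>"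
      using False \<rho>0 \<beta> by (simp add: powr_mono2)
    also have "\<dots> \<le> C2' * \<rho> powr \<beta>" by (intro mult_right_mono) (auto simp: C2'_def)
    finally show ?thesis .
  qed
  define R where "R = primitive_max f - primitive_min f"
  have R: "0 < R" using ne by (simp add: R_def)
  define \<Gamma> where "\<Gamma> = (4 * Lam\<^sup>2 / (C1 * (min (lam / (4 * Lam)) (\<rho>0 / R)) powr \<alpha>)) powr (1 / (2 + \<alpha>))"
  have \<Gamma>: "0 \<le> \<Gamma>" by (simp add: \<Gamma>_def)
  define K where "K = (Lam powr p * C2' + (2 * Lam) powr p * (\<Gamma> powr p + 2 * Lam powr p)) powr (1 / p)"
  have K: "0 \<le> K" by (simp add: K_def)
  have "Lp_norm p (\<lambda>x. a x - b x) \<le> (K + Lam) * Lp_norm 2 (\<lambda>x. ua' x - ub' x) powr s"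
    if ab: "a \<in> admissible lam Lam" "b \<in> admissible lam Lam"
      and sol: "weak_solution a f ua ua'" "weak_solution b f ub ub'" for a b ua ua' ub ub'
  proof -
    obtain M N where "flux_pair lam Lam f a b ua' ub' M N"
      by (rule flux_pair_exists[OF lam f ab sol])
    then interpret flux_pair lam Lam f a b ua' ub' M N .
    have pos: "0 < measure unit_leb (level_band f \<rho> N)"
      if "0 < \<rho>" "\<rho> \<le> \<rho>0" "N \<in> {primitive_min f<..<primitive_max f}" for \<rho> N
      using low[OF that] C1 that(1) by (auto intro: less_le_trans[rotated])
    have MN: "M \<in> {primitive_min f<..<primitive_max f}" "N \<in> {primitive_min f<..<primitive_max f}"
      by (rule flux_constant_range[OF f ne lam(1) ab(1) sol(1) M \<rho>0 pos], assumption+)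
         (rule flux_constant_range[OF f ne lam(1) ab(2) sol(2) N \<rho>0 pos], assumption+)
    then have "\<bar>M - N\<bar> \<le> R" by (auto simp: R_def)
    then have D: "\<bar>M - N\<bar> \<le> \<Gamma> * \<delta> powr (2 / (2 + \<alpha>))"
      unfolding \<Gamma>_def using low MN(2) by (intro flux_gap C1 \<alpha> \<rho>0 R) auto
    have est: "Lp_norm p (\<lambda>x. a x - b x) \<le> K * y powr (\<beta> / (p + \<beta>))"
      if "0 < y" "\<delta> \<le> y" "\<bar>M - N\<bar> \<le> \<Gamma> * y" for y
      unfolding K_def by (rule Lp_norm_estimate[OF p that \<Gamma> \<beta>]) (rule up'[OF _ MN(2)])
    have \<delta>0: "0 \<le> \<delta>" by (rule Lp_norm_nonneg)
    consider "\<delta> = 0" | "0 < \<delta>" "\<delta> < 1" | "1 \<le> \<delta>" using \<delta>0 by linarith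
    then show ?thesis
    proof cases
      case 1
      \<comment> \<open>Any positive number dominates \<delta> now, so the estimate holds for arbitrarily small y.\<close>
      then have "M = N" using D by simp
      then have "Lp_norm p (\<lambda>x. a x - b x) \<le> K * y powr (\<beta> / (p + \<beta>))" if "0 < y" for y
        using est[of y] that 1 \<Gamma> by simp
      then have "Lp_norm p (\<lambda>x. a x - b x) \<le> 0" by (rule le_zero_if_le_powr) (use p \<beta> in auto)
      then show ?thesis using 1 by simp
    next
      case 2
      \<comment> \<open>For \<delta> < 1 the bound on the gap of the flux constants dominates \<delta> itself.\<close>
      have "\<delta> powr 1 \<le> \<delta> powr (2 / (2 + \<alpha>))" using 2 \<alpha> by (intro powr_mono') auto
      then have "Lp_norm p (\<lambda>x. a x - b x) \<le> K * (\<delta> powr (2 / (2 + \<alpha>))) powr (\<beta> / (p + \<beta>))"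
        using 2 D by (intro est) auto
      also have "\<dots> = K * \<delta> powr (2 * \<beta> / ((2 + \<alpha>) * (p + \<beta>)))" by (simp add: powr_powr)
      also have "\<dots> \<le> K * \<delta> powr s" using 2 s K by (intro mult_left_mono powr_mono') auto
      also have "\<dots> \<le> (K + Lam) * \<delta> powr s" using Lam_pos by (intro mult_right_mono) auto
      finally show ?thesis .
    next
      case 3
      have "Lp_norm p (\<lambda>x. a x - b x) \<le> (K + Lam) * 1" using Lp_norm_le_Lam[OF p(1)] K by simp
      also have "\<dots> \<le> (K + Lam) * \<delta> powr s"
        using 3 s K Lam_pos by (intro mult_left_mono ge_one_powr_ge_zero) auto
      finally show ?thesis .
    qed
  qed
  moreover have "0 < K + Lam" using K lam by simp
  ultimately show ?thesis unfolding holder_stable_def by blast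
qed

text \<open>
For bounded functions \<open>\<bar>a - b\<bar> powr p\<close> is at most a constant times \<open>(a - b)\<^sup>2\<close>.
\<close>
lemma holder_stable_gt_2:
  assumes lam: "0 < lam" "lam < Lam" and f: "integrable unit_leb f" and p: "2 < p"
    and 2: "holder_stable lam Lam f 2 s"
  shows "holder_stable lam Lam f p (2 * s / p)"
proof -
  obtain C where C: "0 < C" and est: "\<And>a b ua ua' ub ub'. a \<in> admissible lam Lam \<Longrightarrow> b \<in> admissible lam Lam \<Longrightarrow>
      weak_solution a f ua ua' \<Longrightarrow> weak_solution b f ub ub' \<Longrightarrow>
      Lp_norm 2 (\<lambda>x. a x - b x) \<le> C * Lp_norm 2 (\<lambda>x. ua' x - ub' x) powr s"
    using 2 unfolding holder_stable_def by blast
  define C' where "C' = Lam powr ((p - 2) / p) * C powr (2 / p)"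
  have "0 < C'" using C lam by (simp add: C'_def)
  moreover have "Lp_norm p (\<lambda>x. a x - b x) \<le> C' * Lp_norm 2 (\<lambda>x. ua' x - ub' x) powr (2 * s / p)"
    if ab: "a \<in> admissible lam Lam" "b \<in> admissible lam Lam"
      and sol: "weak_solution a f ua ua'" "weak_solution b f ub ub'" for a b ua ua' ub ub'
  proof -
    obtain M N where "flux_pair lam Lam f a b ua' ub' M N"
      by (rule flux_pair_exists[OF lam f ab sol])
    then interpret flux_pair lam Lam f a b ua' ub' M N .
    have "Lp_norm p (\<lambda>x. a x - b x) \<le> Lam powr ((p - 2) / p) * Lp_norm 2 (\<lambda>x. a x - b x) powr (2 / p)"
      by (rule Lp_norm_le_L2[OF p])
    also have "\<dots> \<le> Lam powr ((p - 2) / p) * (C * \<delta> powr s) powr (2 / p)"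
      using est[OF ab sol] p by (intro mult_left_mono powr_mono2) (auto simp: Lp_norm_nonneg)
    also have "\<dots> = C' * \<delta> powr (2 * s / p)"
      using C by (simp add: C'_def powr_mult powr_powr mult.commute)
    finally show ?thesis .
  qed
  ultimately show ?thesis unfolding holder_stable_def by blast
qed

text \<open>
  The exponent \<open>2 * \<beta> / ((2 + \<alpha>) * (p + \<beta>))\<close> is at least both members of the maximum: the first has
  the larger denominator, and \<open>p / (p + \<alpha>)\<close> increases with \<open>p\<close>.
\<close>

theorem theorem15:
  fixes lam Lam \<alpha> \<beta> C1 C2 \<rho>0 :: real and f :: "real \<Rightarrow> real"
  assumes "0 < lam" and "lam < Lam"
    and "integrable unit_leb f"
    and "primitive_min f < primitive_max f"
    and "\<alpha> \<ge> 0" and "\<beta> > 0" and "C1 > 0" and "C2 > 0" and "\<rho>0 > 0"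
    and "\<And>\<rho>. 0 < \<rho> \<Longrightarrow> \<rho> \<le> \<rho>0 \<Longrightarrow>
           C1 * \<rho> powr \<alpha>
             \<le> (INF M\<in>{primitive_min f<..<primitive_max f}. measure lebesgue (level_band f \<rho> M))
           \<and> (INF M\<in>{primitive_min f<..<primitive_max f}. measure lebesgue (level_band f \<rho> M))
             \<le> (SUP M\<in>{primitive_min f<..<primitive_max f}. measure lebesgue (level_band f \<rho> M))
           \<and> (SUP M\<in>{primitive_min f<..<primitive_max f}. measure lebesgue (level_band f \<rho> M))
             \<le> C2 * \<rho> powr \<beta>"
  shows "(\<forall>p::real. 1 \<le> p \<and> p \<le> 2 \<longrightarrow>
           (\<exists>C>0. \<forall>a\<in>admissible lam Lam. \<forall>b\<in>admissible lam Lam. \<forall>ua ua' ub ub'.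
              weak_solution a f ua ua' \<and> weak_solution b f ub ub' \<longrightarrow>
              Lp_norm p (\<lambda>x. a x - b x)
                \<le> C * Lp_norm 2 (\<lambda>x. ua' x - ub' x) powr
                    max (2 * \<beta> / ((2 + \<alpha>) * (2 + \<beta>))) (p * \<beta> / ((p + \<alpha>) * (p + \<beta>)))))
       \<and> (\<forall>p::real. 2 < p \<longrightarrow>
           (\<exists>C>0. \<forall>a\<in>admissible lam Lam. \<forall>b\<in>admissible lam Lam. \<forall>ua ua' ub ub'.
              weak_solution a f ua ua' \<and> weak_solution b f ub ub' \<longrightarrow>
              Lp_norm p (\<lambda>x. a x - b x)
                \<le> C * Lp_norm 2 (\<lambda>x. ua' x - ub' x) powr
                    (4 * \<beta> / ((2 + \<alpha>) * (2 + \<beta>) * p))))"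
proof -
  have stable: "holder_stable lam Lam f p s"
    if "1 \<le> p" "p \<le> 2" "0 \<le> s" "s \<le> 2 * \<beta> / ((2 + \<alpha>) * (p + \<beta>))" for p s
  proof (rule holder_stable_le_2[where \<alpha> = \<alpha> and \<beta> = \<beta> and ?C1.0 = C1 and ?C2.0 = C2 and ?\<rho>0.0 = \<rho>0])
    fix \<rho> N assume r: "0 < \<rho>" "\<rho> \<le> \<rho>0" and N: "N \<in> {primitive_min f<..<primitive_max f}"
    show "C1 * \<rho> powr \<alpha> \<le> measure unit_leb (level_band f \<rho> N)"
      using assms(10)[OF r] by (intro level_band_bounds(1)[OF assms(3) N]) auto
    show "measure unit_leb (level_band f \<rho> N) \<le> C2 * \<rho> powr \<beta>"
      using assms(10)[OF r] by (intro level_band_bounds(2)[OF assms(3) N]) auto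
  qed (use assms that in auto)
  show ?thesis
  proof (intro conjI allI impI)
    fix p :: real assume p: "1 \<le> p \<and> p \<le> 2"
    let ?s = "max (2 * \<beta> / ((2 + \<alpha>) * (2 + \<beta>))) (p * \<beta> / ((p + \<alpha>) * (p + \<beta>)))"
    have "2 * \<beta> / ((2 + \<alpha>) * (2 + \<beta>)) \<le> 2 * \<beta> / ((2 + \<alpha>) * (p + \<beta>))"
      using p assms by (intro divide_left_mono mult_left_mono mult_pos_pos) auto
    moreover have "p * \<beta> / ((p + \<alpha>) * (p + \<beta>)) \<le> 2 * \<beta> / ((2 + \<alpha>) * (p + \<beta>))"
    proof -
      have "p * \<alpha> \<le> 2 * \<alpha>" using p assms by (intro mult_right_mono) auto
      then have "p / (p + \<alpha>) \<le> 2 / (2 + \<alpha>)" using p assms by (simp add: field_simps)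
      then have "p / (p + \<alpha>) * (\<beta> / (p + \<beta>)) \<le> 2 / (2 + \<alpha>) * (\<beta> / (p + \<beta>))"
        using p assms by (intro mult_right_mono) auto
      then show ?thesis by simp
    qed
    moreover have "0 \<le> 2 * \<beta> / ((2 + \<alpha>) * (2 + \<beta>))" using assms by simp
    ultimately have "holder_stable lam Lam f p ?s" using p by (intro stable) auto
    then show "\<exists>C>0. \<forall>a\<in>admissible lam Lam. \<forall>b\<in>admissible lam Lam. \<forall>ua ua' ub ub'.
              weak_solution a f ua ua' \<and> weak_solution b f ub ub' \<longrightarrow>
              Lp_norm p (\<lambda>x. a x - b x) \<le> C * Lp_norm 2 (\<lambda>x. ua' x - ub' x) powr ?s"
      by (simp only: holder_stable_def)
  next
    fix p :: real assume p: "2 < p"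
    have "holder_stable lam Lam f 2 (2 * \<beta> / ((2 + \<alpha>) * (2 + \<beta>)))"
      using assms by (intro stable) auto
    from holder_stable_gt_2[OF assms(1-3) p this]
    have "holder_stable lam Lam f p (4 * \<beta> / ((2 + \<alpha>) * (2 + \<beta>) * p))" by simp
    then show "\<exists>C>0. \<forall>a\<in>admissible lam Lam. \<forall>b\<in>admissible lam Lam. \<forall>ua ua' ub ub'.
              weak_solution a f ua ua' \<and> weak_solution b f ub ub' \<longrightarrow>
              Lp_norm p (\<lambda>x. a x - b x)
                \<le> C * Lp_norm 2 (\<lambda>x. ua' x - ub' x) powr (4 * \<beta> / ((2 + \<alpha>) * (2 + \<beta>) * p))"
      by (simp only: holder_stable_def)
  qed
qed

end
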